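(* For every finite connectivity space $(X,\mathcal{K})$, one has \[(X,\mathcal{K})\sim_{\mathrm{M}}(\mathrm{Irr}_{(X,\mathcal{K})},\subset),\] i.e. the topos $Sh(X,\mathcal{K})$ is equivalent to the category of presheaves of sets on the poset $(\mathrm{Irr}_{(X,\mathcal{K})},\subset)$ of irreducible connected subsets of $(X,\mathcal{K})$ ordered by inclusion.
   Context: A connectivity structure on a set $X$ is a set $\mathcal{K}\subset\mathcal{P}X$ of subsets (called connected) with $\emptyset\in\mathcal{K}$ such that the union of any family of members of $\mathcal{K}$ with non-empty intersection belongs to $\mathcal{K}$ (singletons need not be connected). The pair $(X,\mathcal{K})$ is a connectivity space; it is finite if $X$ is finite. For $\mathcal{A}\subset\mathcal{P}X$, $[\mathcal{A}]$ denotes the connectivity structure on $X$ generated by $\mathcal{A}$, i.e. the smallest (for inclusion) connectivity structure on $X$ containing $\mathcal{A}$. A connected subset $A\in\mathcal{K}$ is irreducible if $A\notin[\mathcal{K}\setminus\{A\}]$ (so $\emptyset$ is never irreducible); $\mathrm{Irr}_{(X,\mathcal{K})}$ is the set of irreducible connected subsets. The poset $(\mathcal{K},\subset)$ is regarded as a small category. A sieve on $A\in\mathcal{K}$ is a pair $\sigma=(\dot\sigma,A)$ with $\dot\sigma\subset\mathcal{K}\cap\mathcal{P}A$ and $\mathcal{K}\cap\mathcal{P}B\subset\dot\sigma$ for all $B\in\dot\sigma$ (possibly $\dot\sigma=\emptyset$). The site of $(X,\mathcal{K})$ is $(\mathcal{K},J)$, where the covering sieves $J(A)$ of $A\in\mathcal{K}$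 are the sieves $\sigma$ on $A$ with $[\dot\sigma]=\mathcal{K}\cap\mathcal{P}A$ (this is a Grothendieck topology), and $Sh(X,\mathcal{K})$ is the topos of sheaves of sets on $(\mathcal{K},J)$. The topos of a poset $(P,\leq)$ is the category of functors $(P,\leq)^{op}\to\mathbf{Set}$ (presheaves). $\sim_{\mathrm{M}}$ (Morita equivalence) means that the associated topoi are equivalent categories. *)

theory Defs
  imports Main "HOL-Library.FuncSet" "HOL-Library.Equipollence"
begin

section \<open>Connectivity spaces\<close>

text \<open>The empty family satisfies the union condition trivially: its union is the empty set,
  which is required to be connected anyway.\<close>

definition connectivity_space :: "'a set \<Rightarrow> 'a set set \<Rightarrow> bool" where
  "connectivity_space X K \<longleftrightarrow>
     K \<subseteq> Pow X \<and> {} \<in> K \<and> (\<forall>\<F>. \<F> \<subseteq> K \<and> \<Inter>\<F> \<noteq> {} \<longrightarrow> \<Union>\<F> \<in> K)"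

definition generated :: "'a set \<Rightarrow> 'a set set \<Rightarrow> 'a set set" where
  "generated X \<A> = \<Inter>{K. connectivity_space X K \<and> \<A> \<subseteq> K}"

definition Irr :: "'a set \<Rightarrow> 'a set set \<Rightarrow> 'a set set" where
  "Irr X K = {A \<in> K. A \<notin> generated X (K - {A})}"

definition is_sieve :: "'a set set \<Rightarrow> 'a set \<Rightarrow> 'a set set \<Rightarrow> bool" where
  "is_sieve K A S \<longleftrightarrow> S \<subseteq> K \<inter> Pow A \<and> (\<forall>B\<in>S. K \<inter> Pow B \<subseteq> S)"

definition covering_sieves :: "'a set \<Rightarrow> 'a set set \<Rightarrow> 'a set \<Rightarrow> 'a set set set" where
  "covering_sieves X K A = {S. is_sieve K A S \<and> generated X S = K \<inter> Pow A}"

lemma connectivity_space_generated: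
  assumes "\<A> \<subseteq> Pow X"
  shows "connectivity_space X (generated X \<A>)"
proof -
  have P: "connectivity_space X (Pow X)"
    unfolding connectivity_space_def by blast
  have "generated X \<A> \<subseteq> Pow X"
    unfolding generated_def using P assms by blast
  then show ?thesis
    unfolding connectivity_space_def
  proof (intro conjI allI impI)
    show "{} \<in> generated X \<A>"
      unfolding generated_def connectivity_space_def by simp
  next
    fix \<F> assume \<F>: "\<F> \<subseteq> generated X \<A> \<and> \<Inter>\<F> \<noteq> {}"
    show "\<Union>\<F> \<in> generated X \<A>"
      unfolding generated_def
    proof (rule InterI)
      fix K assume "K \<in> {K. connectivity_space X K \<and> \<A> \<subseteq> K}"
      then have "connectivity_space X K" "\<F> \<subseteq> K"
        using \<F> unfolding generated_def by blast+
      then show "\<Union>\<F> \<in> K"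
        using \<F> unfolding connectivity_space_def by simp
    qed
  qed
qed

lemma generated_least:
  assumes "connectivity_space X K" "\<A> \<subseteq> K"
  shows "generated X \<A> \<subseteq> K"
  using assms unfolding generated_def by blast

lemma subset_generated: "\<A> \<subseteq> generated X \<A>"
  unfolding generated_def by blast


section \<open>Categories, functors and equivalences\<close>

text \<open>Hom-sets need not be disjoint, so composition carries the three objects involved:
  \<open>Comp C a b c g f\<close> is the composite of \<open>f : a \<rightarrow> b\<close> followed by \<open>g : b \<rightarrow> c\<close>.\<close>

record ('o, 'm) cat =
  Ob :: "'o set"
  Hom :: "'o \<Rightarrow> 'o \<Rightarrow> 'm set"
  Ident :: "'o \<Rightarrow> 'm"
  Comp :: "'o \<Rightarrow> 'o \<Rightarrow> 'o \<Rightarrow> 'm \<Rightarrow> 'm \<Rightarrow> 'm"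

definition category :: "('o, 'm) cat \<Rightarrow> bool" where
  "category C \<longleftrightarrow>
     (\<forall>a\<in>Ob C. Ident C a \<in> Hom C a a) \<and>
     (\<forall>a\<in>Ob C. \<forall>b\<in>Ob C. \<forall>c\<in>Ob C. \<forall>f\<in>Hom C a b. \<forall>g\<in>Hom C b c.
        Comp C a b c g f \<in> Hom C a c) \<and>
     (\<forall>a\<in>Ob C. \<forall>b\<in>Ob C. \<forall>f\<in>Hom C a b.
        Comp C a a b f (Ident C a) = f \<and> Comp C a b b (Ident C b) f = f) \<and>
     (\<forall>a\<in>Ob C. \<forall>b\<in>Ob C. \<forall>c\<in>Ob C. \<forall>d\<in>Ob C.
        \<forall>f\<in>Hom C a b. \<forall>g\<in>Hom C b c. \<forall>h\<in>Hom C c d.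
        Comp C a c d h (Comp C a b c g f) = Comp C a b d (Comp C b c d h g) f)"

definition is_iso :: "('o, 'm) cat \<Rightarrow> 'o \<Rightarrow> 'o \<Rightarrow> 'm \<Rightarrow> bool" where
  "is_iso C a b f \<longleftrightarrow>
     f \<in> Hom C a b \<and>
     (\<exists>g\<in>Hom C b a. Comp C a b a g f = Ident C a \<and> Comp C b a b f g = Ident C b)"

definition op_cat :: "('o, 'm) cat \<Rightarrow> ('o, 'm) cat" where
  "op_cat C = \<lparr>Ob = Ob C, Hom = (\<lambda>a b. Hom C b a), Ident = Ident C,
               Comp = (\<lambda>a b c g f. Comp C c b a f g)\<rparr>"

definition full_subcat :: "('o, 'm) cat \<Rightarrow> ('o \<Rightarrow> bool) \<Rightarrow> ('o, 'm) cat" where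
  "full_subcat C P = C\<lparr>Ob := {a \<in> Ob C. P a}\<rparr>"

record ('o, 'm, 'p, 'n) fctr =
  fob :: "'o \<Rightarrow> 'p"
  far :: "'o \<Rightarrow> 'o \<Rightarrow> 'm \<Rightarrow> 'n"

definition is_functor ::
  "('o, 'm) cat \<Rightarrow> ('p, 'n) cat \<Rightarrow> ('o, 'm, 'p, 'n) fctr \<Rightarrow> bool" where
  "is_functor C D F \<longleftrightarrow>
     (\<forall>a\<in>Ob C. fob F a \<in> Ob D) \<and>
     (\<forall>a\<in>Ob C. \<forall>b\<in>Ob C. \<forall>f\<in>Hom C a b. far F a b f \<in> Hom D (fob F a) (fob F b)) \<and>
     (\<forall>a\<in>Ob C. far F a a (Ident C a) = Ident D (fob F a)) \<and>
     (\<forall>a\<in>Ob C. \<forall>b\<in>Ob C. \<forall>c\<in>Ob C. \<forall>f\<in>Hom C a b. \<forall>g\<in>Hom C b c.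
        far F a c (Comp C a b c g f) =
        Comp D (fob F a) (fob F b) (fob F c) (far F b c g) (far F a b f))"

text \<open>A functor is only determined on the objects and arrows of its source; the following
  predicate fixes its values elsewhere, so that functors which agree on their source are equal.\<close>

definition functor_ext :: "('o, 'm) cat \<Rightarrow> ('o, 'm, 'p, 'n) fctr \<Rightarrow> bool" where
  "functor_ext C F \<longleftrightarrow>
     (\<forall>a. a \<notin> Ob C \<longrightarrow> fob F a = undefined) \<and>
     (\<forall>a b f. \<not> (a \<in> Ob C \<and> b \<in> Ob C \<and> f \<in> Hom C a b) \<longrightarrow> far F a b f = undefined)"

definition id_functor :: "('o, 'm, 'o, 'm) fctr" where
  "id_functor = \<lparr>fob = (\<lambda>a. a), far = (\<lambda>a b f. f)\<rparr>"

definition comp_functor ::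
  "('p, 'n, 'q, 'l) fctr \<Rightarrow> ('o, 'm, 'p, 'n) fctr \<Rightarrow> ('o, 'm, 'q, 'l) fctr" where
  "comp_functor G F =
     \<lparr>fob = (\<lambda>a. fob G (fob F a)),
      far = (\<lambda>a b f. far G (fob F a) (fob F b) (far F a b f))\<rparr>"

definition is_nat ::
  "('o, 'm) cat \<Rightarrow> ('p, 'n) cat \<Rightarrow> ('o, 'm, 'p, 'n) fctr \<Rightarrow> ('o, 'm, 'p, 'n) fctr \<Rightarrow>
   ('o \<Rightarrow> 'n) \<Rightarrow> bool" where
  "is_nat C D F G \<eta> \<longleftrightarrow>
     (\<forall>a\<in>Ob C. \<eta> a \<in> Hom D (fob F a) (fob G a)) \<and>
     (\<forall>a\<in>Ob C. \<forall>b\<in>Ob C. \<forall>f\<in>Hom C a b.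
        Comp D (fob F a) (fob F b) (fob G b) (\<eta> b) (far F a b f) =
        Comp D (fob F a) (fob G a) (fob G b) (far G a b f) (\<eta> a))"

definition naturally_isomorphic ::
  "('o, 'm) cat \<Rightarrow> ('p, 'n) cat \<Rightarrow> ('o, 'm, 'p, 'n) fctr \<Rightarrow> ('o, 'm, 'p, 'n) fctr \<Rightarrow> bool" where
  "naturally_isomorphic C D F G \<longleftrightarrow>
     (\<exists>\<eta>. is_nat C D F G \<eta> \<and> (\<forall>a\<in>Ob C. is_iso D (fob F a) (fob G a) (\<eta> a)))"

definition equivalent_categories :: "('o, 'm) cat \<Rightarrow> ('p, 'n) cat \<Rightarrow> bool" where
  "equivalent_categories C D \<longleftrightarrow>
     category C \<and> category D \<and>
     (\<exists>F G. is_functor C D F \<and> is_functor D C G \<and>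
        naturally_isomorphic C C (comp_functor G F) id_functor \<and>
        naturally_isomorphic D D (comp_functor F G) id_functor)"

definition functor_cat ::
  "('o, 'm) cat \<Rightarrow> ('p, 'n) cat \<Rightarrow> (('o, 'm, 'p, 'n) fctr, 'o \<Rightarrow> 'n) cat" where
  "functor_cat C D =
     \<lparr>Ob = {F. is_functor C D F \<and> functor_ext C F},
      Hom = (\<lambda>F G. {\<eta> \<in> extensional (Ob C). is_nat C D F G \<eta>}),
      Ident = (\<lambda>F. \<lambda>a\<in>Ob C. Ident D (fob F a)),
      Comp = (\<lambda>F G H \<theta> \<eta>. \<lambda>a\<in>Ob C. Comp D (fob F a) (fob G a) (fob H a) (\<theta> a) (\<eta> a))\<rparr>"

definition poset_cat :: "'p::order set \<Rightarrow> ('p, unit) cat" where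
  "poset_cat P =
     \<lparr>Ob = P, Hom = (\<lambda>a b. if a \<le> b then {()} else {}), Ident = (\<lambda>a. ()),
      Comp = (\<lambda>a b c g f. ())\<rparr>"


section \<open>Sets, presheaves and sheaves\<close>

text \<open>
  There is no type of all sets, so the category of sets is taken relative to a universe \<open>U\<close>,
  a collection of sets with elements in a type \<open>'v\<close>. Only the following closure properties
  are required: some nonempty set is in \<open>U\<close>, every set over \<open>'v\<close> that injects into a member
  of \<open>U\<close> is in \<open>U\<close>, and \<open>U\<close> is closed under binary products up to bijection.
  They hold when \<open>'v\<close> is a model of set theory and \<open>U\<close> consists of the small sets over \<open>'v\<close>
  (those that are the set of elements of some member of \<open>'v\<close>), when \<open>'v\<close> is infinite and \<open>U\<close>
  consists of all sets over \<open>'v\<close>, and when \<open>U\<close> consists of all sets over an infinite \<open>'v\<close>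
  of cardinality below a fixed infinite cardinal.
\<close>

definition set_universe :: "'v set set \<Rightarrow> bool" where
  "set_universe U \<longleftrightarrow>
     (\<exists>A\<in>U. A \<noteq> {}) \<and>
     (\<forall>A\<in>U. \<forall>B. B \<lesssim> A \<longrightarrow> B \<in> U) \<and>
     (\<forall>A\<in>U. \<forall>B\<in>U. \<exists>C\<in>U. C \<approx> A \<times> B)"

definition set_cat :: "'v set set \<Rightarrow> ('v set, 'v \<Rightarrow> 'v) cat" where
  "set_cat U =
     \<lparr>Ob = U, Hom = (\<lambda>A B. A \<rightarrow>\<^sub>E B), Ident = (\<lambda>A. \<lambda>x\<in>A. x),
      Comp = (\<lambda>A B C g f. compose A g f)\<rparr>"

type_synonym ('p, 'v) presheaf = "('p, unit, 'v set, 'v \<Rightarrow> 'v) fctr"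

definition presheaf_topos ::
  "'v set set \<Rightarrow> 'p::order set \<Rightarrow> (('p, 'v) presheaf, 'p \<Rightarrow> 'v \<Rightarrow> 'v) cat" where
  "presheaf_topos U P = functor_cat (op_cat (poset_cat P)) (set_cat U)"

text \<open>For \<open>B \<le> A\<close>, the restriction map \<open>F A \<rightarrow> F B\<close> of a presheaf is \<open>far F A B ()\<close>.\<close>

definition matching_family ::
  "('p::order, 'v) presheaf \<Rightarrow> 'p set \<Rightarrow> ('p \<Rightarrow> 'v) \<Rightarrow> bool" where
  "matching_family F S x \<longleftrightarrow>
     (\<forall>B\<in>S. x B \<in> fob F B) \<and>
     (\<forall>B\<in>S. \<forall>C\<in>S. C \<le> B \<longrightarrow> far F B C () (x B) = x C)"

definition is_sheaf ::
  "'p::order set \<Rightarrow> ('p \<Rightarrow> 'p set set) \<Rightarrow> ('p, 'v) presheaf \<Rightarrow> bool" where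
  "is_sheaf P J F \<longleftrightarrow>
     (\<forall>A\<in>P. \<forall>S\<in>J A. \<forall>x. matching_family F S x \<longrightarrow>
        (\<exists>!s. s \<in> fob F A \<and> (\<forall>B\<in>S. far F A B () s = x B)))"

definition sheaf_topos ::
  "'v set set \<Rightarrow> 'a set \<Rightarrow> 'a set set \<Rightarrow>
   (('a set, 'v) presheaf, 'a set \<Rightarrow> 'v \<Rightarrow> 'v) cat" where
  "sheaf_topos U X K = full_subcat (presheaf_topos U K) (is_sheaf K (covering_sieves X K))"


section \<open>Basic facts\<close>

lemma set_universe_UNIV:
  assumes "infinite (UNIV :: 'v set)"
  shows "set_universe (UNIV :: 'v set set)"
proof -
  have "\<exists>C :: 'v set. C \<approx> A \<times> B" for A B :: "'v set"
  proof -
    obtain f where f: "bij_betw f ((UNIV :: 'v set) \<times> (UNIV :: 'v set)) (UNIV :: 'v set)"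
      using card_of_Times_same_infinite[OF assms] card_of_ordIso by blast
    then have "inj_on f (A \<times> B)"
      by (meson bij_betw_def inj_on_subset subset_UNIV Sigma_mono)
    then show ?thesis
      by (blast intro: inj_on_image_eqpoll_self)
  qed
  then show ?thesis
    unfolding set_universe_def by blast
qed

lemma category_poset_cat: "category (poset_cat P)"
  unfolding category_def poset_cat_def by (auto split: if_splits intro: order_trans)

lemma category_op_cat: "category C \<Longrightarrow> category (op_cat C)"
  unfolding category_def op_cat_def by simp

lemma category_full_subcat: "category C \<Longrightarrow> category (full_subcat C P)"
  unfolding category_def full_subcat_def by simp

lemma category_set_cat: "category (set_cat U)"
proof -
  have "compose A f (\<lambda>x\<in>A. x) = f" "compose A (\<lambda>x\<in>B. x) f = f" if "f \<in> A \<rightarrow>\<^sub>E B"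
    for A B :: "'a set" and f
    using that by (auto simp: compose_def PiE_iff extensional_def fun_eq_iff)
  moreover have "compose A g f \<in> A \<rightarrow>\<^sub>E C" if "f \<in> A \<rightarrow>\<^sub>E B" "g \<in> B \<rightarrow>\<^sub>E C"
    for A B C :: "'a set" and f g
    using that by (auto simp: compose_def PiE_iff)
  moreover have "compose A h (compose A g f) = compose A (compose B h g) f"
    if "f \<in> A \<rightarrow>\<^sub>E B" for A B :: "'a set" and f g h
    using that by (auto simp: compose_def PiE_iff fun_eq_iff)
  moreover have "(\<lambda>x\<in>A. x) \<in> A \<rightarrow>\<^sub>E A" for A :: "'a set"
    by auto
  ultimately show ?thesis
    unfolding category_def set_cat_def cat.simps by (intro conjI ballI; simp only:)
qed

lemma category_functor_cat:
  assumes "category C" and D: "category D"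
  shows "category (functor_cat C D)"
proof -
  have idc: "Ident D a \<in> Hom D a a" if "a \<in> Ob D" for a
    using D that unfolding category_def by blast
  have cmp: "Comp D a b c g f \<in> Hom D a c"
    if "a \<in> Ob D" "b \<in> Ob D" "c \<in> Ob D" "f \<in> Hom D a b" "g \<in> Hom D b c" for a b c f g
    using D that unfolding category_def by blast
  have idl: "Comp D a b b (Ident D b) f = f"
    and idr: "Comp D a a b f (Ident D a) = f"
    if "a \<in> Ob D" "b \<in> Ob D" "f \<in> Hom D a b" for a b f
    using D that unfolding category_def by blast+
  have asc: "Comp D a c d h (Comp D a b c g f) = Comp D a b d (Comp D b c d h g) f"
    if "a \<in> Ob D" "b \<in> Ob D" "c \<in> Ob D" "d \<in> Ob D"
      "f \<in> Hom D a b" "g \<in> Hom D b c" "h \<in> Hom D c d" for a b c d f g h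
    using D that unfolding category_def by blast
  have fo: "fob F a \<in> Ob D" if "is_functor C D F" "a \<in> Ob C" for F a
    using that unfolding is_functor_def by blast
  have fa: "far F a b f \<in> Hom D (fob F a) (fob F b)"
    if "is_functor C D F" "a \<in> Ob C" "b \<in> Ob C" "f \<in> Hom C a b" for F a b f
    using that unfolding is_functor_def by blast
  have nt: "\<eta> a \<in> Hom D (fob F a) (fob G a)" if "is_nat C D F G \<eta>" "a \<in> Ob C" for F G \<eta> a
    using that unfolding is_nat_def by blast
  have sq: "Comp D (fob F a) (fob F b) (fob G b) (\<eta> b) (far F a b f) =
      Comp D (fob F a) (fob G a) (fob G b) (far G a b f) (\<eta> a)"
    if "is_nat C D F G \<eta>" "a \<in> Ob C" "b \<in> Ob C" "f \<in> Hom C a b" for F G \<eta> a b f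
    using that unfolding is_nat_def by blast
  have nat_id: "is_nat C D F F (\<lambda>a\<in>Ob C. Ident D (fob F a))" if "is_functor C D F" for F
    unfolding is_nat_def using that by (simp add: idc idl idr fo fa)
  have nat_comp:
    "is_nat C D F H (\<lambda>a\<in>Ob C. Comp D (fob F a) (fob G a) (fob H a) (\<theta> a) (\<eta> a))"
    if F: "is_functor C D F" and G: "is_functor C D G" and H: "is_functor C D H"
      and \<eta>: "is_nat C D F G \<eta>" and \<theta>: "is_nat C D G H \<theta>" for F G H \<eta> \<theta>
    unfolding is_nat_def
  proof (intro conjI ballI)
    fix a assume "a \<in> Ob C"
    then show "(\<lambda>a\<in>Ob C. Comp D (fob F a) (fob G a) (fob H a) (\<theta> a) (\<eta> a)) a
        \<in> Hom D (fob F a) (fob H a)"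
      by (simp add: cmp fo[OF F] fo[OF G] fo[OF H] nt[OF \<eta>] nt[OF \<theta>])
  next
    fix a b f assume ab: "a \<in> Ob C" "b \<in> Ob C" "f \<in> Hom C a b"
    note t = fo[OF F] fo[OF G] fo[OF H] nt[OF \<eta>] nt[OF \<theta>] fa[OF F] fa[OF G] fa[OF H] ab
    have "Comp D (fob F a) (fob F b) (fob H b)
        (Comp D (fob F b) (fob G b) (fob H b) (\<theta> b) (\<eta> b)) (far F a b f) =
      Comp D (fob F a) (fob G b) (fob H b) (\<theta> b)
        (Comp D (fob F a) (fob F b) (fob G b) (\<eta> b) (far F a b f))"
      by (intro asc[symmetric] t)
    also have "\<dots> = Comp D (fob F a) (fob G b) (fob H b) (\<theta> b)
        (Comp D (fob F a) (fob G a) (fob G b) (far G a b f) (\<eta> a))"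
      by (simp only: sq[OF \<eta> ab])
    also have "\<dots> = Comp D (fob F a) (fob G a) (fob H b)
        (Comp D (fob G a) (fob G b) (fob H b) (\<theta> b) (far G a b f)) (\<eta> a)"
      by (intro asc t)
    also have "\<dots> = Comp D (fob F a) (fob G a) (fob H b)
        (Comp D (fob G a) (fob H a) (fob H b) (far H a b f) (\<theta> a)) (\<eta> a)"
      by (simp only: sq[OF \<theta> ab])
    also have "\<dots> = Comp D (fob F a) (fob H a) (fob H b) (far H a b f)
        (Comp D (fob F a) (fob G a) (fob H a) (\<theta> a) (\<eta> a))"
      by (intro asc[symmetric] t)
    finally show "Comp D (fob F a) (fob F b) (fob H b)
        ((\<lambda>a\<in>Ob C. Comp D (fob F a) (fob G a) (fob H a) (\<theta> a) (\<eta> a)) b) (far F a b f) =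
      Comp D (fob F a) (fob H a) (fob H b) (far H a b f)
        ((\<lambda>a\<in>Ob C. Comp D (fob F a) (fob G a) (fob H a) (\<theta> a) (\<eta> a)) a)"
      using ab by simp
  qed
  have unit_r: "(\<lambda>a\<in>Ob C. Comp D (fob F a) (fob F a) (fob G a) (\<eta> a)
        ((\<lambda>a\<in>Ob C. Ident D (fob F a)) a)) = \<eta>"
    and unit_l: "(\<lambda>a\<in>Ob C. Comp D (fob F a) (fob G a) (fob G a)
        ((\<lambda>a\<in>Ob C. Ident D (fob G a)) a) (\<eta> a)) = \<eta>"
    if "is_functor C D F" "is_functor C D G" "is_nat C D F G \<eta>" "\<eta> \<in> extensional (Ob C)"
    for F G \<eta>
    by (rule extensionalityI[where A = "Ob C"]; use that in \<open>simp add: idl idr fo nt\<close>)+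
  have assoc: "(\<lambda>a\<in>Ob C. Comp D (fob F a) (fob H a) (fob L a) (\<zeta> a)
        ((\<lambda>a\<in>Ob C. Comp D (fob F a) (fob G a) (fob H a) (\<theta> a) (\<eta> a)) a)) =
      (\<lambda>a\<in>Ob C. Comp D (fob F a) (fob G a) (fob L a)
        ((\<lambda>a\<in>Ob C. Comp D (fob G a) (fob H a) (fob L a) (\<zeta> a) (\<theta> a)) a) (\<eta> a))"
    if "is_functor C D F" "is_functor C D G" "is_functor C D H" "is_functor C D L"
      "is_nat C D F G \<eta>" "is_nat C D G H \<theta>" "is_nat C D H L \<zeta>" for F G H L \<eta> \<theta> \<zeta>
  proof (rule restrict_ext)
    fix a assume a: "a \<in> Ob C"
    show "Comp D (fob F a) (fob H a) (fob L a) (\<zeta> a)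
        ((\<lambda>a\<in>Ob C. Comp D (fob F a) (fob G a) (fob H a) (\<theta> a) (\<eta> a)) a) =
      Comp D (fob F a) (fob G a) (fob L a)
        ((\<lambda>a\<in>Ob C. Comp D (fob G a) (fob H a) (fob L a) (\<zeta> a) (\<theta> a)) a) (\<eta> a)"
      using a that by (simp add: asc[of "fob F a" "fob G a" "fob H a" "fob L a"] fo nt)
  qed
  show ?thesis
    unfolding category_def functor_cat_def cat.simps mem_Collect_eq
    apply (intro conjI ballI)
          apply (rule restrict_extensional)
         apply (rule nat_id, blast)
        apply (rule restrict_extensional)
       apply (rule nat_comp; blast)
      apply (rule unit_r; blast)
     apply (rule unit_l; blast)
    apply (rule assoc; blast)
    done
qed

lemma category_presheaf_topos: "category (presheaf_topos U P)"
  unfolding presheaf_topos_def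
  by (intro category_functor_cat category_op_cat category_poset_cat category_set_cat)

lemma category_sheaf_topos: "category (sheaf_topos U X K)"
  unfolding sheaf_topos_def by (intro category_full_subcat category_presheaf_topos)

end

theory Submission imports Defs begin

text \<open>In a finite connectivity space every connected set is covered by the irreducible sets below
  it (induction on its size), and an irreducible set belongs to every covering sieve of every
  connected set above it, since it cannot be generated by other connected sets. Hence a sheaf is
  determined by its values on irreducible sets: its sections over \<open>A\<close> are the matching families on
  the irreducible subsets of \<open>A\<close>, and conversely the matching families of any presheaf on the
  irreducible sets form a sheaf. So restriction to the irreducible sets is fully faithful and
  essentially surjective.\<close>

section \<open>Fully faithful and essentially surjective functors\<close>

text \<open>The sheaf argument is carried out for an abstract site, \<open>rigid_site\<close>, whose
  assumptions isolate what is needed of the irreducible sets. Three obstacles shape the rest. The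
  irreducible sets below \<open>A\<close> need not form a sieve in \<open>K\<close>, so a family on
  them must first be extended to the sieve they generate before the sheaf condition can be applied.
  Irreducibility of \<open>A\<close> is tested against all of \<open>K\<close>, whereas the
  induction needs a reducible \<open>A\<close> to be generated by its proper connected subsets;
  \<open>generated_proper_subsets\<close> bridges this gap. Finally, matching families are functions
  and not elements of \<open>'v\<close>, while \<open>set_universe\<close> gives only binary
  products up to bijection. Finiteness therefore serves twice: for the induction, and to embed the
  set of matching families into a finite product that fits in \<open>U\<close>.\<close>

lemma equivalent_categoriesI:
  fixes C :: "('o, 'm) cat" and D :: "('p, 'n) cat"
  assumes C: "category C" and D: "category D" and F: "is_functor C D F"
    and ff: "\<And>a b. a \<in> Ob C \<Longrightarrow> b \<in> Ob C \<Longrightarrow>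
      bij_betw (far F a b) (Hom C a b) (Hom D (fob F a) (fob F b))"
    and es: "\<And>d. d \<in> Ob D \<Longrightarrow> \<exists>c\<in>Ob C. \<exists>e. is_iso D (fob F c) d e"
  shows "equivalent_categories C D"
proof -
  have idC: "Ident C a \<in> Hom C a a" if "a \<in> Ob C" for a
    using C that unfolding category_def by blast
  have cmpC: "Comp C a b c g f \<in> Hom C a c"
    if "a \<in> Ob C" "b \<in> Ob C" "c \<in> Ob C" "f \<in> Hom C a b" "g \<in> Hom C b c" for a b c f g
    using C that unfolding category_def by blast
  have idD: "Ident D a \<in> Hom D a a" if "a \<in> Ob D" for a
    using D that unfolding category_def by blast
  have cmpD: "Comp D a b c g f \<in> Hom D a c"
    if "a \<in> Ob D" "b \<in> Ob D" "c \<in> Ob D" "f \<in> Hom D a b" "g \<in> Hom D b c" for a b c f g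
    using D that unfolding category_def by blast
  have idl: "Comp D a b b (Ident D b) f = f"
    and idr: "Comp D a a b f (Ident D a) = f"
    if "a \<in> Ob D" "b \<in> Ob D" "f \<in> Hom D a b" for a b f
    using D that unfolding category_def by blast+
  have asc: "Comp D a c d h (Comp D a b c g f) = Comp D a b d (Comp D b c d h g) f"
    if "a \<in> Ob D" "b \<in> Ob D" "c \<in> Ob D" "d \<in> Ob D"
      "f \<in> Hom D a b" "g \<in> Hom D b c" "h \<in> Hom D c d" for a b c d f g h
    using D that unfolding category_def by blast
  have fo: "fob F a \<in> Ob D" if "a \<in> Ob C" for a
    using F that unfolding is_functor_def by blast
  have fa: "far F a b f \<in> Hom D (fob F a) (fob F b)"
    if "a \<in> Ob C" "b \<in> Ob C" "f \<in> Hom C a b" for a b f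
    using F that unfolding is_functor_def by blast
  have fi: "far F a a (Ident C a) = Ident D (fob F a)" if "a \<in> Ob C" for a
    using F that unfolding is_functor_def by blast
  have fc: "far F a c (Comp C a b c g f) =
      Comp D (fob F a) (fob F b) (fob F c) (far F b c g) (far F a b f)"
    if "a \<in> Ob C" "b \<in> Ob C" "c \<in> Ob C" "f \<in> Hom C a b" "g \<in> Hom C b c" for a b c f g
    using F that unfolding is_functor_def by blast
  have faithful: "f = f'" if "a \<in> Ob C" "b \<in> Ob C" "f \<in> Hom C a b" "f' \<in> Hom C a b"
      "far F a b f = far F a b f'" for a b f f'
    using ff[of a b] that unfolding bij_betw_def inj_on_def by blast
  \<comment> \<open>\<open>L\<close> inverts \<open>F\<close> on hom-sets. Each equation required in
    \<open>C\<close> is obtained by applying \<open>F\<close>, checking the image in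
    \<open>D\<close>, and cancelling \<open>F\<close> with \<open>faithful\<close>.\<close>
  define L where "L a b = inv_into (Hom C a b) (far F a b)" for a b
  have L: "L a b h \<in> Hom C a b" "far F a b (L a b h) = h"
    if "a \<in> Ob C" "b \<in> Ob C" "h \<in> Hom D (fob F a) (fob F b)" for a b h
    using ff[of a b] that unfolding L_def bij_betw_def
    by (auto intro: inv_into_into f_inv_into_f)
  have "\<forall>d\<in>Ob D. \<exists>c e. c \<in> Ob C \<and> is_iso D (fob F c) d e"
    using es by blast
  then obtain k e where k: "\<And>d. d \<in> Ob D \<Longrightarrow> k d \<in> Ob C"
    and e_iso: "\<And>d. d \<in> Ob D \<Longrightarrow> is_iso D (fob F (k d)) d (e d)"
    by metis
  have "\<forall>d\<in>Ob D. \<exists>e'. e' \<in> Hom D d (fob F (k d)) \<and>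
      Comp D (fob F (k d)) d (fob F (k d)) e' (e d) = Ident D (fob F (k d)) \<and>
      Comp D d (fob F (k d)) d (e d) e' = Ident D d"
    using e_iso unfolding is_iso_def by blast
  then obtain e' where e': "\<And>d. d \<in> Ob D \<Longrightarrow> e' d \<in> Hom D d (fob F (k d))"
    and e'e: "\<And>d. d \<in> Ob D \<Longrightarrow>
      Comp D (fob F (k d)) d (fob F (k d)) (e' d) (e d) = Ident D (fob F (k d))"
    and ee': "\<And>d. d \<in> Ob D \<Longrightarrow> Comp D d (fob F (k d)) d (e d) (e' d) = Ident D d"
    by metis
  have e: "e d \<in> Hom D (fob F (k d)) d" if "d \<in> Ob D" for d
    using e_iso[OF that] unfolding is_iso_def by blast
  \<comment> \<open>Conjugation of \<open>h\<close> by the chosen isomorphisms: the value that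
    \<open>F (G h)\<close> must have for \<open>e\<close> to be natural.\<close>
  define T where "T a b h =
    Comp D (fob F (k a)) b (fob F (k b)) (e' b) (Comp D (fob F (k a)) a b h (e a))" for a b h
  have T: "T a b h \<in> Hom D (fob F (k a)) (fob F (k b))"
    if "a \<in> Ob D" "b \<in> Ob D" "h \<in> Hom D a b" for a b h
    unfolding T_def using that by (simp add: cmpD fo k e e')
  have eT: "Comp D (fob F (k a)) (fob F (k b)) b (e b) (T a b h) =
      Comp D (fob F (k a)) a b h (e a)"
    if "a \<in> Ob D" "b \<in> Ob D" "h \<in> Hom D a b" for a b h
    unfolding T_def using that
    by (subst asc[where b = b]) (simp_all add: cmpD fo k e e' ee' idl)
  \<comment> \<open>Each \<open>e d\<close> has the left inverse \<open>e' d\<close>. Functoriality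
    of \<open>T\<close> can thus be checked after composing with \<open>e\<close>, where
    \<open>eT\<close> moves \<open>e\<close> past one factor at a time.\<close>
  have e_cancel: "u = v"
    if "a \<in> Ob D" "d \<in> Ob D" "u \<in> Hom D a (fob F (k d))" "v \<in> Hom D a (fob F (k d))"
      "Comp D a (fob F (k d)) d (e d) u = Comp D a (fob F (k d)) d (e d) v" for a d u v
  proof -
    have "w = Comp D a d (fob F (k d)) (e' d) (Comp D a (fob F (k d)) d (e d) w)"
      if "w \<in> Hom D a (fob F (k d))" for w
      using that \<open>a \<in> Ob D\<close> \<open>d \<in> Ob D\<close>
      by (subst asc) (simp_all add: fo k e e' e'e idl)
    then show ?thesis
      using that by metis
  qed
  define G where "G = \<lparr>fob = k, far = (\<lambda>a b h. L (k a) (k b) (T a b h))\<rparr>"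
  have G_hom: "far G a b h \<in> Hom C (k a) (k b)" and FG: "far F (k a) (k b) (far G a b h) = T a b h"
    if "a \<in> Ob D" "b \<in> Ob D" "h \<in> Hom D a b" for a b h
    unfolding G_def using that by (simp_all add: L k T)
  have G_ob: "fob G = k"
    unfolding G_def by simp
  have G: "is_functor D C G"
    unfolding is_functor_def G_ob
  proof (intro conjI ballI)
    fix a assume a: "a \<in> Ob D"
    show "k a \<in> Ob C"
      using a by (rule k)
    have "T a a (Ident D a) = Ident D (fob F (k a))"
      unfolding T_def using a by (simp add: idl e fo k e'e)
    then have "far F (k a) (k a) (far G a a (Ident D a)) = far F (k a) (k a) (Ident C (k a))"
      using a by (simp add: FG idD fi k)
    then show "far G a a (Ident D a) = Ident C (k a)"
      by (intro faithful[of "k a" "k a"]) (use a in \<open>simp_all add: k G_hom idC idD\<close>)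
  next
    fix a b h assume "a \<in> Ob D" "b \<in> Ob D" "h \<in> Hom D a b"
    then show "far G a b h \<in> Hom C (k a) (k b)"
      by (rule G_hom)
  next
    fix a b c f g
    assume a: "a \<in> Ob D" and b: "b \<in> Ob D" and c: "c \<in> Ob D"
      and f: "f \<in> Hom D a b" and g: "g \<in> Hom D b c"
    note t = a b c f g
    note s = cmpD fo k e T idD t
    have "Comp D (fob F (k a)) (fob F (k c)) c (e c)
        (Comp D (fob F (k a)) (fob F (k b)) (fob F (k c)) (T b c g) (T a b f)) =
      Comp D (fob F (k a)) (fob F (k b)) c
        (Comp D (fob F (k b)) (fob F (k c)) c (e c) (T b c g)) (T a b f)"
      by (intro asc s)
    also have "\<dots> = Comp D (fob F (k a)) (fob F (k b)) c
        (Comp D (fob F (k b)) b c g (e b)) (T a b f)"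
      by (simp only: eT[OF b c g])
    also have "\<dots> = Comp D (fob F (k a)) b c g
        (Comp D (fob F (k a)) (fob F (k b)) b (e b) (T a b f))"
      by (intro asc[symmetric] s)
    also have "\<dots> = Comp D (fob F (k a)) b c g (Comp D (fob F (k a)) a b f (e a))"
      by (simp only: eT[OF a b f])
    also have "\<dots> = Comp D (fob F (k a)) a c (Comp D a b c g f) (e a)"
      by (intro asc s)
    also have "\<dots> = Comp D (fob F (k a)) (fob F (k c)) c (e c) (T a c (Comp D a b c g f))"
      by (rule eT[symmetric]) (intro s)+
    finally have "Comp D (fob F (k a)) (fob F (k b)) (fob F (k c)) (T b c g) (T a b f) =
        T a c (Comp D a b c g f)"
      by (rule e_cancel[rotated 4]) (intro s)+
    then have "far F (k a) (k c) (far G a c (Comp D a b c g f)) =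
        far F (k a) (k c) (Comp C (k a) (k b) (k c) (far G b c g) (far G a b f))"
      using t by (simp add: FG fc k G_hom cmpD[of a b c])
    then show "far G a c (Comp D a b c g f) =
        Comp C (k a) (k b) (k c) (far G b c g) (far G a b f)"
      by (intro faithful[of "k a" "k c"]) (use t in \<open>simp_all add: k G_hom cmpC cmpD[of a b c]\<close>)
  qed
  have "naturally_isomorphic D D (comp_functor F G) id_functor"
    unfolding naturally_isomorphic_def
  proof (intro exI conjI ballI)
    show "is_nat D D (comp_functor F G) id_functor e"
      unfolding is_nat_def comp_functor_def id_functor_def G_ob
      by (simp add: e FG eT)
    show "is_iso D (fob (comp_functor F G) d) (fob id_functor d) (e d)" if "d \<in> Ob D" for d
      using e_iso[OF that] by (simp add: comp_functor_def id_functor_def G_ob)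
  qed
  moreover have "naturally_isomorphic C C (comp_functor G F) id_functor"
    unfolding naturally_isomorphic_def
  proof (intro exI conjI ballI)
    \<comment> \<open>Lifts along \<open>F\<close> of the isomorphisms \<open>e\<close> and
      \<open>e'\<close> at \<open>fob F c\<close>; they inherit naturality and invertibility because
      \<open>F\<close> is faithful.\<close>
    define \<eta> where "\<eta> c = L (k (fob F c)) c (e (fob F c))" for c
    define \<eta>' where "\<eta>' c = L c (k (fob F c)) (e' (fob F c))" for c
    have \<eta>: "\<eta> c \<in> Hom C (k (fob F c)) c" "far F (k (fob F c)) c (\<eta> c) = e (fob F c)"
      and \<eta>': "\<eta>' c \<in> Hom C c (k (fob F c))" "far F c (k (fob F c)) (\<eta>' c) = e' (fob F c)"
      if "c \<in> Ob C" for c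
      unfolding \<eta>_def \<eta>'_def using that by (simp_all add: L k fo e e')
    show "is_nat C C (comp_functor G F) id_functor \<eta>"
      unfolding is_nat_def comp_functor_def id_functor_def G_ob fctr.simps
    proof (intro conjI ballI)
      fix a b f assume t: "a \<in> Ob C" "b \<in> Ob C" "f \<in> Hom C a b"
      note s = k fo fa \<eta> G_hom t
      show "Comp C (k (fob F a)) (k (fob F b)) b (\<eta> b)
          (far G (fob F a) (fob F b) (far F a b f)) = Comp C (k (fob F a)) a b f (\<eta> a)"
      proof (rule faithful[of "k (fob F a)" b])
        show "far F (k (fob F a)) b (Comp C (k (fob F a)) (k (fob F b)) b (\<eta> b)
            (far G (fob F a) (fob F b) (far F a b f))) =
          far F (k (fob F a)) b (Comp C (k (fob F a)) a b f (\<eta> a))"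
          using t by (simp add: fc s FG eT)
      qed (intro cmpC s)+
    qed (simp add: \<eta>)
    fix c assume c: "c \<in> Ob C"
    have "Comp C (k (fob F c)) c (k (fob F c)) (\<eta>' c) (\<eta> c) = Ident C (k (fob F c))"
      by (rule faithful[of "k (fob F c)" "k (fob F c)"])
        (use c in \<open>simp_all add: fc k fo \<eta> \<eta>' cmpC idC fi e'e\<close>)
    moreover have "Comp C c (k (fob F c)) c (\<eta> c) (\<eta>' c) = Ident C c"
      by (rule faithful[of c c])
        (use c in \<open>simp_all add: fc k fo \<eta> \<eta>' cmpC idC fi ee'\<close>)
    ultimately show "is_iso C (fob (comp_functor G F) c) (fob id_functor c) (\<eta> c)"
      unfolding is_iso_def comp_functor_def id_functor_def G_ob fctr.simps
      using c \<eta> \<eta>' by blast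
  qed
  ultimately show ?thesis
    unfolding equivalent_categories_def using C D F G by blast
qed


section \<open>Presheaves on a poset\<close>

text \<open>Functoriality into \<open>set_cat U\<close>, with equations between arrows replaced by
  equations at elements. Arrows of \<open>set_cat U\<close> are extensional, which makes this
  equivalent to \<open>is_functor\<close> (see \<open>is_functor_iff_presheaf\<close>). Values off
  \<open>P\<close> are left to \<open>functor_ext\<close>.\<close>

definition presheaf :: "'v set set \<Rightarrow> 'p::order set \<Rightarrow> ('p, 'v) presheaf \<Rightarrow> bool" where
  "presheaf U P F \<longleftrightarrow>
     (\<forall>A\<in>P. fob F A \<in> U) \<and>
     (\<forall>A\<in>P. \<forall>B\<in>P. B \<le> A \<longrightarrow> far F A B () \<in> fob F A \<rightarrow>\<^sub>E fob F B) \<and>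
     (\<forall>A\<in>P. \<forall>s\<in>fob F A. far F A A () s = s) \<and>
     (\<forall>A\<in>P. \<forall>B\<in>P. \<forall>C\<in>P. B \<le> A \<longrightarrow> C \<le> B \<longrightarrow>
        (\<forall>s\<in>fob F A. far F B C () (far F A B () s) = far F A C () s))"

definition presheaf_map ::
  "'p::order set \<Rightarrow> ('p, 'v) presheaf \<Rightarrow> ('p, 'v) presheaf \<Rightarrow> ('p \<Rightarrow> 'v \<Rightarrow> 'v) \<Rightarrow> bool" where
  "presheaf_map P F G \<eta> \<longleftrightarrow>
     (\<forall>A\<in>P. \<eta> A \<in> fob F A \<rightarrow>\<^sub>E fob G A) \<and>
     (\<forall>A\<in>P. \<forall>B\<in>P. B \<le> A \<longrightarrow>
        (\<forall>s\<in>fob F A. \<eta> B (far F A B () s) = far G A B () (\<eta> A s)))"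

lemma op_poset_simps [simp]:
  "Ob (op_cat (poset_cat P)) = P"
  "Hom (op_cat (poset_cat P)) = (\<lambda>a b. if b \<le> a then {()} else {})"
  "Ident (op_cat (poset_cat P)) = (\<lambda>a. ())"
  "Comp (op_cat (poset_cat P)) = (\<lambda>a b c g f. ())"
  by (simp_all add: op_cat_def poset_cat_def)

lemma set_cat_simps [simp]:
  "Ob (set_cat U) = U"
  "Hom (set_cat U) = (\<lambda>A B. A \<rightarrow>\<^sub>E B)"
  "Ident (set_cat U) = (\<lambda>A. \<lambda>x\<in>A. x)"
  "Comp (set_cat U) = (\<lambda>A B C g f. compose A g f)"
  by (simp_all add: set_cat_def)

lemma presheafD:
  assumes "presheaf U P F"
  shows "A \<in> P \<Longrightarrow> fob F A \<in> U"
    and "A \<in> P \<Longrightarrow> B \<in> P \<Longrightarrow> B \<le> A \<Longrightarrow> far F A B () \<in> fob F A \<rightarrow>\<^sub>E fob F B"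
    and "A \<in> P \<Longrightarrow> B \<in> P \<Longrightarrow> B \<le> A \<Longrightarrow> s \<in> fob F A \<Longrightarrow> far F A B () s \<in> fob F B"
    and "A \<in> P \<Longrightarrow> s \<in> fob F A \<Longrightarrow> far F A A () s = s"
    and "A \<in> P \<Longrightarrow> B \<in> P \<Longrightarrow> C \<in> P \<Longrightarrow> B \<le> A \<Longrightarrow> C \<le> B \<Longrightarrow> s \<in> fob F A \<Longrightarrow>
      far F B C () (far F A B () s) = far F A C () s"
  using assms by (simp_all add: presheaf_def PiE_mem[of "far F A B ()" "fob F A" "\<lambda>_. fob F B"])

lemma presheaf_mapD:
  assumes "presheaf_map P F G \<eta>"
  shows "A \<in> P \<Longrightarrow> \<eta> A \<in> fob F A \<rightarrow>\<^sub>E fob G A"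
    and "A \<in> P \<Longrightarrow> s \<in> fob F A \<Longrightarrow> \<eta> A s \<in> fob G A"
    and "A \<in> P \<Longrightarrow> B \<in> P \<Longrightarrow> B \<le> A \<Longrightarrow> s \<in> fob F A \<Longrightarrow>
      \<eta> B (far F A B () s) = far G A B () (\<eta> A s)"
  using assms by (simp_all add: presheaf_map_def PiE_mem[of "\<eta> A" "fob F A" "\<lambda>_. fob G A"])

lemma Ball_if_unit: "(\<forall>f\<in>(if b then {()} else {}). Q f) \<longleftrightarrow> (b \<longrightarrow> Q ())"
  by simp

lemma is_functor_iff_presheaf:
  "is_functor (op_cat (poset_cat P)) (set_cat U) F \<longleftrightarrow> presheaf U P F"
proof -
  have id: "far F A A () = (\<lambda>x\<in>fob F A. x) \<longleftrightarrow> (\<forall>s\<in>fob F A. far F A A () s = s)"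
    if "far F A A () \<in> fob F A \<rightarrow>\<^sub>E fob F A" for A
    using that by (auto simp: PiE_iff extensional_def fun_eq_iff)
  have comp: "far F A C () = compose (fob F A) (far F B C ()) (far F A B ()) \<longleftrightarrow>
      (\<forall>s\<in>fob F A. far F B C () (far F A B () s) = far F A C () s)"
    if "far F A C () \<in> fob F A \<rightarrow>\<^sub>E fob F C" for A B C
    using that by (auto simp: PiE_iff extensional_def fun_eq_iff compose_def)
  note unfold = is_functor_def op_poset_simps set_cat_simps Ball_if_unit
  show ?thesis
  proof
    assume F: "is_functor (op_cat (poset_cat P)) (set_cat U) F"
    note F' = F[unfolded unfold]
    have F_ob: "fob F A \<in> U" if "A \<in> P" for A
      by (rule F'[THEN conjunct1, rule_format, OF that])
    have arr: "far F A B () \<in> fob F A \<rightarrow>\<^sub>E fob F B" if "A \<in> P" "B \<in> P" "B \<le> A" for A B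
      by (rule F'[THEN conjunct2, THEN conjunct1, rule_format, OF that])
    have F_id: "far F A A () = (\<lambda>x\<in>fob F A. x)" if "A \<in> P" for A
      by (rule F'[THEN conjunct2, THEN conjunct2, THEN conjunct1, rule_format, OF that])
    have F_comp: "far F A C () = compose (fob F A) (far F B C ()) (far F A B ())"
      if "A \<in> P" "B \<in> P" "C \<in> P" "B \<le> A" "C \<le> B" for A B C
      by (rule F'[THEN conjunct2, THEN conjunct2, THEN conjunct2, rule_format, OF that])
    show "presheaf U P F"
      unfolding presheaf_def
    proof (intro conjI ballI impI)
      show "far F A A () s = s" if "A \<in> P" "s \<in> fob F A" for A s
        using id[OF arr[OF that(1,1) order_refl]] F_id that by blast
      show "far F B C () (far F A B () s) = far F A C () s"
        if "A \<in> P" "B \<in> P" "C \<in> P" "B \<le> A" "C \<le> B" "s \<in> fob F A" for A B C s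
        using comp[OF arr[OF that(1,3) order_trans[OF that(5,4)]]] F_comp[OF that(1-5)] that(6)
        by blast
    qed (use F_ob arr in blast)+
  next
    assume F: "presheaf U P F"
    show "is_functor (op_cat (poset_cat P)) (set_cat U) F"
      unfolding unfold
    proof (intro conjI ballI impI)
      show "far F A A () = (\<lambda>x\<in>fob F A. x)" if "A \<in> P" for A
        using id[OF presheafD(2)[OF F that that order_refl]] presheafD(4)[OF F that] by blast
      show "far F A C () = compose (fob F A) (far F B C ()) (far F A B ())"
        if "A \<in> P" "B \<in> P" "C \<in> P" "B \<le> A" "C \<le> B" for A B C
        using comp[OF presheafD(2)[OF F that(1,3) order_trans[OF that(5,4)]]]
          presheafD(5)[OF F that] by blast
    qed (use presheafD(1,2)[OF F] in blast)+
  qed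
qed

lemma is_nat_iff_presheaf_map:
  assumes F: "presheaf U P F" and G: "presheaf U P G"
  shows "is_nat (op_cat (poset_cat P)) (set_cat U) F G \<eta> \<longleftrightarrow> presheaf_map P F G \<eta>"
proof -
  have "compose (fob F A) (\<eta> B) (far F A B ()) = compose (fob F A) (far G A B ()) (\<eta> A) \<longleftrightarrow>
      (\<forall>s\<in>fob F A. \<eta> B (far F A B () s) = far G A B () (\<eta> A s))" for A B
    by (auto simp: compose_def fun_eq_iff restrict_def)
  then show ?thesis
    unfolding is_nat_def presheaf_map_def by auto
qed

lemma presheaf_topos_Ob:
  "F \<in> Ob (presheaf_topos U P) \<longleftrightarrow> presheaf U P F \<and> functor_ext (op_cat (poset_cat P)) F"
  by (simp add: presheaf_topos_def functor_cat_def is_functor_iff_presheaf)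

lemma presheaf_topos_Hom:
  assumes "presheaf U P F" "presheaf U P G"
  shows "\<eta> \<in> Hom (presheaf_topos U P) F G \<longleftrightarrow> \<eta> \<in> extensional P \<and> presheaf_map P F G \<eta>"
  using assms by (simp add: presheaf_topos_def functor_cat_def is_nat_iff_presheaf_map)

lemma presheaf_topos_simps [simp]:
  "Ident (presheaf_topos U P) = (\<lambda>F. \<lambda>A\<in>P. \<lambda>x\<in>fob F A. x)"
  "Comp (presheaf_topos U P) = (\<lambda>F G H \<theta> \<eta>. \<lambda>A\<in>P. compose (fob F A) (\<theta> A) (\<eta> A))"
  by (simp_all add: presheaf_topos_def functor_cat_def)

lemma full_subcat_simps [simp]:
  "Ob (full_subcat C p) = {a \<in> Ob C. p a}"
  "Hom (full_subcat C p) = Hom C"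
  "Ident (full_subcat C p) = Ident C"
  "Comp (full_subcat C p) = Comp C"
  by (simp_all add: full_subcat_def)

lemma matching_familyD:
  assumes "matching_family F S x"
  shows "B \<in> S \<Longrightarrow> x B \<in> fob F B"
    and "B \<in> S \<Longrightarrow> C \<in> S \<Longrightarrow> C \<le> B \<Longrightarrow> far F B C () (x B) = x C"
  using assms by (simp_all add: matching_family_def)

text \<open>The pointwise inverses are automatically natural: apply the inverse at \<open>B\<close>
  to the naturality square of \<open>\<eta>\<close>.\<close>

lemma is_iso_presheaf_topos:
  assumes F: "presheaf U P F" and G: "presheaf U P G"
    and \<eta>: "presheaf_map P F G \<eta>" "\<eta> \<in> extensional P"
    and bij: "\<And>A. A \<in> P \<Longrightarrow> bij_betw (\<eta> A) (fob F A) (fob G A)"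
  shows "is_iso (presheaf_topos U P) F G \<eta>"
proof -
  define \<theta> where "\<theta> = (\<lambda>A\<in>P. \<lambda>t\<in>fob G A. inv_into (fob F A) (\<eta> A) t)"
  have \<theta>: "\<theta> A t \<in> fob F A" "\<eta> A (\<theta> A t) = t" if "A \<in> P" "t \<in> fob G A" for A t
    using bij[OF that(1)] that unfolding \<theta>_def bij_betw_def
    by (auto intro: inv_into_into f_inv_into_f)
  have \<theta>_unique: "\<theta> A (\<eta> A s) = s" if "A \<in> P" "s \<in> fob F A" for A s
    using bij[OF that(1)] that presheaf_mapD(2)[OF \<eta>(1) that] unfolding \<theta>_def bij_betw_def
    by simp
  have "presheaf_map P G F \<theta>"
    unfolding presheaf_map_def
  proof (intro conjI ballI impI)
    show "\<theta> A \<in> fob G A \<rightarrow>\<^sub>E fob F A" if "A \<in> P" for A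
      using \<theta>(1)[OF that] that by (auto simp: PiE_iff \<theta>_def)
    fix A B t assume t: "A \<in> P" "B \<in> P" "B \<le> A" "t \<in> fob G A"
    have "\<eta> B (far F A B () (\<theta> A t)) = far G A B () t"
      using presheaf_mapD(3)[OF \<eta>(1) t(1-3) \<theta>(1)[OF t(1,4)]] \<theta>(2)[OF t(1,4)] by simp
    moreover have "far F A B () (\<theta> A t) \<in> fob F B"
      using presheafD(3)[OF F t(1-3) \<theta>(1)[OF t(1,4)]] .
    ultimately show "\<theta> B (far G A B () t) = far F A B () (\<theta> A t)"
      using \<theta>_unique[OF t(2)] by metis
  qed
  moreover have "\<theta> \<in> extensional P"
    unfolding \<theta>_def by simp
  moreover have "(\<lambda>A\<in>P. compose (fob F A) (\<theta> A) (\<eta> A)) = (\<lambda>A\<in>P. \<lambda>x\<in>fob F A. x)"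
    by (auto simp: compose_def \<theta>_unique intro!: restrict_ext)
  moreover have "(\<lambda>A\<in>P. compose (fob G A) (\<eta> A) (\<theta> A)) = (\<lambda>A\<in>P. \<lambda>x\<in>fob G A. x)"
    by (auto simp: compose_def \<theta> intro!: restrict_ext)
  ultimately show ?thesis
    unfolding is_iso_def using \<eta> by (auto simp: presheaf_topos_Hom[OF F G] presheaf_topos_Hom[OF G F])
qed

text \<open>Induction on \<open>I\<close> from binary products. Only an injection can be asked for,
  since the elements of the product are functions and not elements of \<open>'v\<close>; this
  suffices for encoding matching families.\<close>

lemma set_universe_PiE:
  assumes U: "set_universe U" and "finite I" and "\<And>i. i \<in> I \<Longrightarrow> A i \<in> U"
  shows "\<exists>C\<in>U. (\<Pi>\<^sub>E i\<in>I. A i) \<lesssim> C"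
  using assms(2,3)
proof (induction I rule: finite_induct)
  case empty
  \<comment> \<open>The empty product has one element, so any nonempty member of \<open>U\<close>
    receives it.\<close>
  obtain C c where "C \<in> U" "c \<in> C"
    using U unfolding set_universe_def by blast
  then show ?case
    by (auto simp: lepoll_def intro!: bexI[of _ C] exI[of _ "\<lambda>_. c"])
next
  case (insert i I)
  then obtain C where C: "C \<in> U" "(\<Pi>\<^sub>E i\<in>I. A i) \<lesssim> C"
    by auto
  obtain E where E: "E \<in> U" "E \<approx> A i \<times> C"
    using U insert.prems[of i] C(1) unfolding set_universe_def by blast
  have "inj_on (\<lambda>f. (f i, restrict f I)) (\<Pi>\<^sub>E i\<in>insert i I. A i)"
  proof (rule inj_onI)
    fix f g assume fg: "f \<in> (\<Pi>\<^sub>E i\<in>insert i I. A i)" "g \<in> (\<Pi>\<^sub>E i\<in>insert i I. A i)"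
      "(f i, restrict f I) = (g i, restrict g I)"
    then have "f j = g j" if "j \<in> insert i I" for j
      using that by (metis insertE prod.inject restrict_apply')
    then show "f = g"
      using fg by (intro PiE_ext)
  qed
  moreover have "(\<lambda>f. (f i, restrict f I)) ` (\<Pi>\<^sub>E i\<in>insert i I. A i) \<subseteq> A i \<times> (\<Pi>\<^sub>E i\<in>I. A i)"
    by (auto simp: PiE_iff)
  ultimately have "(\<Pi>\<^sub>E i\<in>insert i I. A i) \<lesssim> A i \<times> (\<Pi>\<^sub>E i\<in>I. A i)"
    unfolding lepoll_def by blast
  also have "\<dots> \<lesssim> A i \<times> C"
    using C(2) by (intro times_lepoll_mono lepoll_refl)
  also have "\<dots> \<lesssim> E"
    using E(2) by (simp add: eqpoll_imp_lepoll eqpoll_sym)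
  finally show ?case
    using E(1) by blast
qed


section \<open>Rigid sites\<close>

text \<open>When \<open>J\<close> consists of sieves, \<open>Q_in_cover\<close> says that the elements of \<open>Q\<close> have no covering
  sieve except the maximal one.\<close>

locale rigid_site =
  fixes U :: "'v set set" and P Q :: "'p::order set" and J :: "'p \<Rightarrow> 'p set set"
  assumes universe: "set_universe U"
    and Q_subset: "Q \<subseteq> P"
    and finite_below: "A \<in> P \<Longrightarrow> finite {I \<in> Q. I \<le> A}"
    and Q_covers: "A \<in> P \<Longrightarrow> {B \<in> P. \<exists>I\<in>Q. B \<le> I \<and> I \<le> A} \<in> J A"
    and Q_in_cover: "A \<in> P \<Longrightarrow> S \<in> J A \<Longrightarrow> I \<in> Q \<Longrightarrow> I \<le> A \<Longrightarrow> I \<in> S"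
    and cover_below: "A \<in> P \<Longrightarrow> S \<in> J A \<Longrightarrow> B \<in> S \<Longrightarrow> B \<in> P \<and> B \<le> A"
begin

lemma Q_P: "I \<in> Q \<Longrightarrow> I \<in> P"
  using Q_subset by blast

text \<open>The defaults \<open>undefined\<close> and \<open>restrict\<close> are those demanded by
  \<open>functor_ext\<close> and \<open>extensional\<close>, so that the results are objects and
  arrows of \<open>presheaf_topos U Q\<close>.\<close>

definition restriction :: "(('p, 'v) presheaf, 'p \<Rightarrow> 'v \<Rightarrow> 'v, ('p, 'v) presheaf, 'p \<Rightarrow> 'v \<Rightarrow> 'v) fctr"
  where "restriction =
    \<lparr>fob = (\<lambda>F. \<lparr>fob = (\<lambda>A. if A \<in> Q then fob F A else undefined),
        far = (\<lambda>A B f. if A \<in> Q \<and> B \<in> Q \<and> B \<le> A then far F A B f else undefined)\<rparr>),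
      far = (\<lambda>F G \<eta>. restrict \<eta> Q)\<rparr>"

lemma restriction_simps [simp]:
  "I \<in> Q \<Longrightarrow> fob (fob restriction F) I = fob F I"
  "I \<in> Q \<Longrightarrow> L \<in> Q \<Longrightarrow> L \<le> I \<Longrightarrow> far (fob restriction F) I L f = far F I L f"
  "far restriction F G \<eta> = restrict \<eta> Q"
  by (simp_all add: restriction_def)

lemma presheaf_restriction: "presheaf U P F \<Longrightarrow> presheaf U Q (fob restriction F)"
  unfolding presheaf_def using order_trans Q_P by (auto simp: Q_P)

lemma functor_ext_restriction: "functor_ext (op_cat (poset_cat Q)) (fob restriction F)"
  unfolding functor_ext_def by (auto simp: restriction_def)

lemma presheaf_map_restriction:
  "presheaf_map P F G \<eta> \<Longrightarrow>
    presheaf_map Q (fob restriction F) (fob restriction G) (restrict \<eta> Q)"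
  unfolding presheaf_map_def by (auto simp: Q_P)

abbreviation sheaves :: "(('p, 'v) presheaf, 'p \<Rightarrow> 'v \<Rightarrow> 'v) cat" where
  "sheaves \<equiv> full_subcat (presheaf_topos U P) (is_sheaf P J)"

lemma is_functor_restriction: "is_functor sheaves (presheaf_topos U Q) restriction"
  unfolding is_functor_def
proof (intro conjI ballI)
  fix F assume F: "F \<in> Ob sheaves"
  then show "fob restriction F \<in> Ob (presheaf_topos U Q)"
    by (simp add: presheaf_topos_Ob presheaf_restriction functor_ext_restriction)
  show "far restriction F F (Ident sheaves F) = Ident (presheaf_topos U Q) (fob restriction F)"
    by (auto simp: Q_P intro!: extensionalityI[where A = Q])
next
  fix F G \<eta> assume "F \<in> Ob sheaves" "G \<in> Ob sheaves" "\<eta> \<in> Hom sheaves F G"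
  then show "far restriction F G \<eta>
      \<in> Hom (presheaf_topos U Q) (fob restriction F) (fob restriction G)"
    by (simp add: presheaf_topos_Ob presheaf_topos_Hom presheaf_restriction
        presheaf_map_restriction)
next
  fix F G H \<eta> \<theta>
  show "far restriction F H (Comp sheaves F G H \<theta> \<eta>) =
      Comp (presheaf_topos U Q) (fob restriction F) (fob restriction G) (fob restriction H)
        (far restriction G H \<theta>) (far restriction F G \<eta>)"
    by (auto simp: Q_P intro!: extensionalityI[where A = Q])
qed

text \<open>Every \<open>B\<close> in the sieve of \<open>Q_covers\<close> lies below some
  \<open>I\<close> in \<open>Q\<close> with \<open>I \<le> A\<close>, so restriction to
  \<open>B\<close> factors through \<open>I\<close>. Agreement on \<open>Q\<close> spreads to the
  whole sieve, and uniqueness of gluing applies.\<close>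

lemma sheaf_separated:
  assumes F: "presheaf U P F" and sh: "is_sheaf P J F" and A: "A \<in> P"
    and s: "s \<in> fob F A" and t: "t \<in> fob F A"
    and eq: "\<And>I. I \<in> Q \<Longrightarrow> I \<le> A \<Longrightarrow> far F A I () s = far F A I () t"
  shows "s = t"
proof -
  let ?S = "{B \<in> P. \<exists>I\<in>Q. B \<le> I \<and> I \<le> A}"
  have "far F A B () t = far F A B () s" if B: "B \<in> ?S" for B
  proof -
    obtain I where I: "I \<in> Q" "B \<le> I" "I \<le> A"
      using B by blast
    have "far F A B () u = far F I B () (far F A I () u)" if "u \<in> fob F A" for u
      using presheafD(5)[OF F A Q_P[OF I(1)] _ I(3,2) that] B by simp
    then show ?thesis
      using s t eq[OF I(1,3)] by simp
  qed
  moreover have "matching_family F ?S (\<lambda>B. far F A B () s)"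
    unfolding matching_family_def
    using presheafD(3)[OF F A _ _ s] presheafD(5)[OF F A _ _ _ _ s] by (auto intro: order_trans)
  then have "\<exists>!u. u \<in> fob F A \<and> (\<forall>B\<in>?S. far F A B () u = far F A B () s)"
    using sh A Q_covers[OF A] unfolding is_sheaf_def by blast
  ultimately show ?thesis
    using s t by blast
qed

text \<open>The family extends to the sieve of \<open>Q_covers\<close> by restricting to
  \<open>B\<close> from a chosen element of \<open>Q\<close> above \<open>B\<close>. Different
  choices need not be comparable, so compatibility is not immediate; it is tested on elements of
  \<open>Q\<close> further down and concluded by \<open>sheaf_separated\<close>.\<close>

lemma sheaf_amalgamation:
  assumes F: "presheaf U P F" and sh: "is_sheaf P J F" and A: "A \<in> P"
    and x: "matching_family F {I \<in> Q. I \<le> A} x"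
  shows "\<exists>s\<in>fob F A. \<forall>I\<in>Q. I \<le> A \<longrightarrow> far F A I () s = x I"
proof -
  let ?S = "{B \<in> P. \<exists>I\<in>Q. B \<le> I \<and> I \<le> A}"
  have x_mem: "x I \<in> fob F I" if "I \<in> Q" "I \<le> A" for I
    using matching_familyD(1)[OF x, of I] that by simp
  have x_res: "far F I L () (x I) = x L" if "I \<in> Q" "I \<le> A" "L \<in> Q" "L \<le> I" for I L
    using matching_familyD(2)[OF x, of I L] that order_trans[of L I A] by simp
  have "\<forall>B\<in>?S. \<exists>I. I \<in> Q \<and> B \<le> I \<and> I \<le> A"
    by blast
  from bchoice[OF this] obtain i where "\<forall>B\<in>?S. i B \<in> Q \<and> B \<le> i B \<and> i B \<le> A"
    by (rule exE)
  then have i: "i B \<in> Q" "B \<le> i B" "i B \<le> A" if "B \<in> ?S" for B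
    using that by simp_all
  have S_P: "B \<in> P" if "B \<in> ?S" for B
    using that by blast
  \<comment> \<open>Nothing relates \<open>i B\<close> to \<open>i C\<close> when
    \<open>C \<le> B\<close>. What does not depend on the choice is the restriction of
    \<open>y B\<close> to elements of \<open>Q\<close>, by \<open>y_res\<close>.\<close>
  define y where "y B = far F (i B) B () (x (i B))" for B
  have y_mem: "y B \<in> fob F B" if "B \<in> ?S" for B
    unfolding y_def using i[OF that] S_P[OF that]
    by (simp add: presheafD(3)[OF F] x_mem Q_P)
  have y_res: "far F B I () (y B) = x I" if B: "B \<in> ?S" and I: "I \<in> Q" "I \<le> B" for B I
  proof -
    have "far F B I () (y B) = far F (i B) I () (x (i B))"
      unfolding y_def using i[OF B] S_P[OF B] I
      by (simp add: presheafD(5)[OF F] x_mem Q_P)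
    also have "\<dots> = x I"
      using i[OF B] I order_trans[of I B "i B"] by (intro x_res) auto
    finally show ?thesis .
  qed
  have "matching_family F ?S y"
    unfolding matching_family_def
  proof (intro conjI ballI impI)
    fix B C assume B: "B \<in> ?S" and C: "C \<in> ?S" and CB: "C \<le> B"
    have BC: "B \<in> P" "C \<in> P"
      using B C by auto
    show "far F B C () (y B) = y C"
    proof (rule sheaf_separated[OF F sh BC(2) _ y_mem[OF C]])
      show "far F B C () (y B) \<in> fob F C"
        by (rule presheafD(3)[OF F BC CB y_mem[OF B]])
      fix I assume I: "I \<in> Q" "I \<le> C"
      have "far F C I () (far F B C () (y B)) = far F B I () (y B)"
        by (rule presheafD(5)[OF F BC Q_P[OF I(1)] CB I(2) y_mem[OF B]])
      also have "\<dots> = far F C I () (y C)"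
        using y_res[OF B I(1)] y_res[OF C I] order_trans[OF I(2) CB] by simp
      finally show "far F C I () (far F B C () (y B)) = far F C I () (y C)" .
    qed
  qed (rule y_mem)
  then obtain s where s: "s \<in> fob F A" "\<forall>B\<in>?S. far F A B () s = y B"
    using sh A Q_covers[OF A] unfolding is_sheaf_def by blast
  have "far F A I () s = x I" if I: "I \<in> Q" "I \<le> A" for I
  proof -
    have IS: "I \<in> ?S"
      using I Q_P by blast
    \<comment> \<open>The chosen \<open>i I\<close> may differ from \<open>I\<close>, so
      \<open>y I = x I\<close> does not hold by definition; it is \<open>y_res\<close> at
      \<open>B = I\<close>.\<close>
    have "y I = far F I I () (y I)"
      using presheafD(4)[OF F Q_P[OF I(1)] y_mem[OF IS]] by simp
    then show ?thesis
      using s(2) IS y_res[OF IS I(1) order_refl] by simp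
  qed
  then show ?thesis
    using s(1) by blast
qed

text \<open>By naturality, \<open>\<eta> A s\<close> and \<open>\<theta> A s\<close> have the same
  restrictions to \<open>Q\<close>, and sections of the sheaf \<open>G\<close> are separated by
  these.\<close>

lemma restriction_faithful:
  assumes F: "presheaf U P F" and G: "presheaf U P G" and sh: "is_sheaf P J G"
    and \<eta>: "presheaf_map P F G \<eta>" "\<eta> \<in> extensional P"
    and \<theta>: "presheaf_map P F G \<theta>" "\<theta> \<in> extensional P"
    and eq: "restrict \<eta> Q = restrict \<theta> Q"
  shows "\<eta> = \<theta>"
proof (rule extensionalityI[OF \<eta>(2) \<theta>(2)])
  fix A assume A: "A \<in> P"
  have "\<eta> A s = \<theta> A s" if s: "s \<in> fob F A" for s
  proof (rule sheaf_separated[OF G sh A presheaf_mapD(2)[OF \<eta>(1) A s] presheaf_mapD(2)[OF \<theta>(1) A s]])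
    fix I assume I: "I \<in> Q" "I \<le> A"
    have "\<eta> I = \<theta> I"
      using eq I(1) by (metis restrict_apply')
    then show "far G A I () (\<eta> A s) = far G A I () (\<theta> A s)"
      using presheaf_mapD(3)[OF \<eta>(1) A Q_P[OF I(1)] I(2) s]
        presheaf_mapD(3)[OF \<theta>(1) A Q_P[OF I(1)] I(2) s] by simp
  qed
  then show "\<eta> A = \<theta> A"
    using presheaf_mapD(1)[OF \<eta>(1) A] presheaf_mapD(1)[OF \<theta>(1) A] by (intro PiE_ext)
qed

text \<open>A section \<open>s\<close> over \<open>A\<close> yields the matching family of all
  \<open>\<theta> I\<close> applied to the restriction of \<open>s\<close> to \<open>I\<close>; its
  amalgamation in \<open>G\<close> is the value of the extended map at \<open>s\<close>. Naturality
  follows by separation.\<close>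

lemma restriction_full:
  assumes F: "presheaf U P F" and G: "presheaf U P G" and sh: "is_sheaf P J G"
    and \<theta>: "presheaf_map Q (fob restriction F) (fob restriction G) \<theta>" "\<theta> \<in> extensional Q"
  shows "\<exists>\<eta>. presheaf_map P F G \<eta> \<and> \<eta> \<in> extensional P \<and> restrict \<eta> Q = \<theta>"
proof -
  have \<theta>_mem: "\<theta> I s \<in> fob G I" if "I \<in> Q" "s \<in> fob F I" for I s
    using presheaf_mapD(2)[OF \<theta>(1)] that by simp
  have \<theta>_nat: "far G I L () (\<theta> I s) = \<theta> L (far F I L () s)"
    if "I \<in> Q" "L \<in> Q" "L \<le> I" "s \<in> fob F I" for I L s
    using presheaf_mapD(3)[OF \<theta>(1)] that by simp
  have "\<exists>t\<in>fob G A. \<forall>I\<in>Q. I \<le> A \<longrightarrow> far G A I () t = \<theta> I (far F A I () s)"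
    if A: "A \<in> P" and s: "s \<in> fob F A" for A s
  proof (rule sheaf_amalgamation[OF G sh A])
    show "matching_family G {I \<in> Q. I \<le> A} (\<lambda>I. \<theta> I (far F A I () s))"
      unfolding matching_family_def
      by (auto simp: \<theta>_mem \<theta>_nat Q_P presheafD(3)[OF F A _ _ s] presheafD(5)[OF F A _ _ _ _ s])
  qed
  then obtain t where t: "\<And>A s. A \<in> P \<Longrightarrow> s \<in> fob F A \<Longrightarrow> t A s \<in> fob G A"
    and t_res: "\<And>A s I. A \<in> P \<Longrightarrow> s \<in> fob F A \<Longrightarrow> I \<in> Q \<Longrightarrow> I \<le> A \<Longrightarrow>
      far G A I () (t A s) = \<theta> I (far F A I () s)"
    by metis
  define \<eta> where "\<eta> = (\<lambda>A\<in>P. \<lambda>s\<in>fob F A. t A s)"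
  have "presheaf_map P F G \<eta>"
    unfolding presheaf_map_def
  proof (intro conjI ballI impI)
    show "\<eta> A \<in> fob F A \<rightarrow>\<^sub>E fob G A" if "A \<in> P" for A
      using that by (auto simp: \<eta>_def t)
    fix A B s assume A: "A \<in> P" and B: "B \<in> P" and BA: "B \<le> A" and s: "s \<in> fob F A"
    note sB = presheafD(3)[OF F A B BA s]
    have "t B (far F A B () s) = far G A B () (t A s)"
    proof (rule sheaf_separated[OF G sh B t[OF B sB] presheafD(3)[OF G A B BA t[OF A s]]])
      fix I assume I: "I \<in> Q" "I \<le> B"
      have "far G B I () (t B (far F A B () s)) = \<theta> I (far F A I () s)"
        by (simp add: t_res[OF B sB I] presheafD(5)[OF F A B Q_P[OF I(1)] BA I(2) s])
      also have "\<dots> = far G B I () (far G A B () (t A s))"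
        using t_res[OF A s I(1) order_trans[OF I(2) BA]]
          presheafD(5)[OF G A B Q_P[OF I(1)] BA I(2) t[OF A s]] by simp
      finally show "far G B I () (t B (far F A B () s)) =
          far G B I () (far G A B () (t A s))" .
    qed
    then show "\<eta> B (far F A B () s) = far G A B () (\<eta> A s)"
      using A B s sB by (simp add: \<eta>_def)
  qed
  moreover have "restrict \<eta> Q = \<theta>"
  proof (rule extensionalityI[OF restrict_extensional \<theta>(2)])
    fix I assume I: "I \<in> Q"
    have "t I s = \<theta> I s" if s: "s \<in> fob F I" for s
      using t_res[OF Q_P[OF I] s I order_refl] presheafD(4)[OF F Q_P[OF I] s]
        presheafD(4)[OF G Q_P[OF I] t[OF Q_P[OF I] s]] by simp
    moreover have "\<theta> I \<in> extensional (fob F I)"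
      using presheaf_mapD(1)[OF \<theta>(1) I] I by (simp add: PiE_iff)
    ultimately show "restrict \<eta> Q I = \<theta> I"
      using I Q_P[OF I] by (auto simp: \<eta>_def intro!: extensionalityI[where A = "fob F I"])
  qed
  ultimately show ?thesis
    unfolding \<eta>_def by (auto intro!: exI[of _ \<eta>] simp: \<eta>_def)
qed

lemma restriction_fully_faithful:
  assumes "F \<in> Ob sheaves" "G \<in> Ob sheaves"
  shows "bij_betw (far restriction F G) (Hom sheaves F G)
    (Hom (presheaf_topos U Q) (fob restriction F) (fob restriction G))"
proof -
  have F: "presheaf U P F" and G: "presheaf U P G" "is_sheaf P J G"
    using assms by (auto simp: presheaf_topos_Ob)
  note Hom = presheaf_topos_Hom[OF F G(1)]
    presheaf_topos_Hom[OF presheaf_restriction[OF F] presheaf_restriction[OF G(1)]]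
  show ?thesis
    unfolding bij_betw_def
  proof (intro conjI inj_onI subset_antisym subsetI)
    fix \<eta> \<theta> assume "\<eta> \<in> Hom sheaves F G" "\<theta> \<in> Hom sheaves F G"
      "far restriction F G \<eta> = far restriction F G \<theta>"
    then show "\<eta> = \<theta>"
      using restriction_faithful[OF F G] by (simp add: Hom)
  next
    fix \<theta> assume "\<theta> \<in> far restriction F G ` Hom sheaves F G"
    then show "\<theta> \<in> Hom (presheaf_topos U Q) (fob restriction F) (fob restriction G)"
      using presheaf_map_restriction by (auto simp: Hom)
  next
    fix \<theta> assume "\<theta> \<in> Hom (presheaf_topos U Q) (fob restriction F) (fob restriction G)"
    then obtain \<eta> where "presheaf_map P F G \<eta>" "\<eta> \<in> extensional P" "restrict \<eta> Q = \<theta>"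
      using restriction_full[OF F G] by (auto simp: Hom)
    then show "\<theta> \<in> far restriction F G ` Hom sheaves F G"
      by (auto simp: Hom intro!: image_eqI[where x = \<eta>])
  qed
qed

text \<open>The extension of a presheaf \<open>G\<close> on \<open>Q\<close> to a sheaf sends \<open>A\<close> to the set of matching families
  of \<open>G\<close> on the elements of \<open>Q\<close> below \<open>A\<close>. These families are not elements of the
  universe, so an injection \<open>c A\<close> encodes them.\<close>

lemma restriction_essentially_surjective:
  assumes G: "presheaf U Q G" and G_ext: "functor_ext (op_cat (poset_cat Q)) G"
  shows "\<exists>F\<in>Ob sheaves. \<exists>\<eta>. is_iso (presheaf_topos U Q) (fob restriction F) G \<eta>"
proof -
  define D where "D A = {I \<in> Q. I \<le> A}" for A
  \<comment> \<open>\<open>M A\<close> is the limit of \<open>G\<close> over the elements of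
    \<open>Q\<close> below \<open>A\<close>, that is, the right Kan extension of \<open>G\<close>
    along \<open>Q \<subseteq> P\<close> at \<open>A\<close>. Extensionality makes each family a
    single function. If nothing of \<open>Q\<close> lies below \<open>A\<close>, as for the empty
    connected set, \<open>M A\<close> has exactly one element.\<close>
  define M where "M A = {x \<in> extensional (D A). matching_family G (D A) x}" for A
  have M_mem: "x I \<in> fob G I" if "x \<in> M A" "I \<in> Q" "I \<le> A" for x A I
    using matching_familyD(1)[of G "D A" x I] that by (simp add: M_def D_def)
  have M_res: "far G I L () (x I) = x L" if "x \<in> M A" "I \<in> Q" "L \<in> Q" "I \<le> A" "L \<le> I" for x A I L
    using matching_familyD(2)[of G "D A" x I L] that order_trans[of L I A]
    by (simp add: M_def D_def)
  have M_ext: "x = y" if "x \<in> M A" "y \<in> M A" "\<And>I. I \<in> Q \<Longrightarrow> I \<le> A \<Longrightarrow> x I = y I" for x y A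
    using that unfolding M_def D_def by (auto intro!: extensionalityI[where A = "{I \<in> Q. I \<le> A}"])
  have M_restrict: "restrict x (D B) \<in> M B" if "x \<in> M A" "B \<le> A" for x A B
    using that unfolding M_def D_def matching_family_def by (auto intro: order_trans)
  have "\<exists>c. inj_on c (M A) \<and> c ` M A \<in> U" if A: "A \<in> P" for A
  proof -
    obtain C where C: "C \<in> U" "(\<Pi>\<^sub>E I\<in>D A. fob G I) \<lesssim> C"
      using set_universe_PiE[OF universe, of "D A" "fob G"] finite_below[OF A] presheafD(1)[OF G]
      unfolding D_def by auto
    have "M A \<subseteq> (\<Pi>\<^sub>E I\<in>D A. fob G I)"
      unfolding M_def matching_family_def by (auto simp: PiE_iff extensional_def)
    then have "M A \<lesssim> C"
      using C(2) subset_imp_lepoll lepoll_trans by blast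
    then obtain c where c: "inj_on c (M A)" "c ` M A \<subseteq> C"
      unfolding lepoll_def by blast
    moreover have "c ` M A \<in> U"
      using universe C(1) subset_imp_lepoll[OF c(2)] unfolding set_universe_def by blast
    ultimately show ?thesis
      by blast
  qed
  then obtain c where c_inj: "\<And>A. A \<in> P \<Longrightarrow> inj_on (c A) (M A)"
    and c_U: "\<And>A. A \<in> P \<Longrightarrow> c A ` M A \<in> U"
    by metis
  define d where "d A = inv_into (M A) (c A)" for A
  have d: "d A (c A x) = x" if "A \<in> P" "x \<in> M A" for A x
    unfolding d_def using c_inj that by simp
  \<comment> \<open>Decode, restrict the family, encode again.\<close>
  define r where "r A B = (\<lambda>v\<in>c A ` M A. c B (restrict (d A v) (D B)))" for A B
  have r: "r A B (c A x) = c B (restrict x (D B))" if "A \<in> P" "x \<in> M A" for A B x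
    unfolding r_def using that d by simp
  define F :: "('p, 'v) presheaf" where "F = \<lparr>fob = (\<lambda>A. if A \<in> P then c A ` M A else undefined),
    far = (\<lambda>A B f. if A \<in> P \<and> B \<in> P \<and> B \<le> A then r A B else undefined)\<rparr>"
  have F_ob: "fob F A = c A ` M A" if "A \<in> P" for A
    unfolding F_def using that by simp
  have F_res: "far F A B () = r A B" if "A \<in> P" "B \<in> P" "B \<le> A" for A B
    unfolding F_def using that by simp
  have F_res_c: "far F A B () (c A x) = c B (restrict x (D B))"
    if "A \<in> P" "B \<in> P" "B \<le> A" "x \<in> M A" for A B x
    using that by (simp add: F_res r)
  have D_mono: "D B \<inter> D C = D C" if "C \<le> B" for B C
    using order_trans[OF _ that] by (auto simp: D_def)
  have F: "presheaf U P F"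
    unfolding presheaf_def
  proof (intro conjI ballI impI)
    show "fob F A \<in> U" if "A \<in> P" for A
      using that by (simp add: F_ob c_U)
    show "far F A B () \<in> fob F A \<rightarrow>\<^sub>E fob F B" if "A \<in> P" "B \<in> P" "B \<le> A" for A B
      using that by (auto simp: F_ob F_res r M_restrict) (simp add: r_def)
    show "far F A A () s = s" if "A \<in> P" "s \<in> fob F A" for A s
      using that by (auto simp: F_ob F_res_c M_def extensional_restrict)
    show "far F B C () (far F A B () s) = far F A C () s"
      if "A \<in> P" "B \<in> P" "C \<in> P" "B \<le> A" "C \<le> B" "s \<in> fob F A" for A B C s
      using that order_trans[OF that(5,4)]
      by (auto simp: F_ob F_res_c M_restrict D_mono)
  qed
  have F_ext: "functor_ext (op_cat (poset_cat P)) F"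
    unfolding functor_ext_def by (auto simp: F_def)
  have sh: "is_sheaf P J F"
    unfolding is_sheaf_def
  proof (intro ballI allI impI)
    fix A S x assume A: "A \<in> P" and S: "S \<in> J A" and x: "matching_family F S x"
    have SP: "B \<in> P" "B \<le> A" if "B \<in> S" for B
      using cover_below[OF A S that] by auto
    define y where "y B = d B (x B)" for B
    have y: "y B \<in> M B" "x B = c B (y B)" if "B \<in> S" for B
      using matching_familyD(1)[OF x that] SP[OF that] d unfolding y_def by (auto simp: F_ob)
    \<comment> \<open>An element \<open>I\<close> of \<open>Q\<close> below \<open>B\<close> belongs
      to \<open>S\<close> by \<open>Q_in_cover\<close>. Compatibility of \<open>x\<close> from
      \<open>B\<close> to \<open>I\<close> then makes the entry at \<open>I\<close> independent of
      \<open>B\<close>.\<close>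
    have y_res: "y B I = y I I" if B: "B \<in> S" and I: "I \<in> Q" "I \<le> B" for B I
    proof -
      have IS: "I \<in> S"
        using Q_in_cover[OF A S I(1)] SP[OF B] I(2) order_trans by blast
      have "c I (restrict (y B) (D I)) = c I (y I)"
        using F_res_c[OF SP(1)[OF B] SP(1)[OF IS] I(2) y(1)[OF B]]
          matching_familyD(2)[OF x B IS I(2)] y(2)[OF B] y(2)[OF IS] by simp
      then have "restrict (y B) (D I) = y I"
        using c_inj[OF SP(1)[OF IS]] M_restrict[OF y(1)[OF B] I(2)] y(1)[OF IS]
        by (blast dest: inj_onD)
      then have "restrict (y B) (D I) I = y I I"
        by simp
      then show ?thesis
        using I by (simp add: D_def)
    qed
    \<comment> \<open>The only candidate for a gluing: its entry at \<open>I\<close> is read off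
      from the member \<open>I\<close> of the cover itself.\<close>
    define s where "s = (\<lambda>I\<in>D A. y I I)"
    have in_S: "I \<in> S" if "I \<in> Q" "I \<le> A" for I
      using Q_in_cover[OF A S that] .
    have s: "s \<in> M A"
      unfolding M_def matching_family_def
    proof (intro CollectI conjI ballI impI)
      show "s \<in> extensional (D A)"
        unfolding s_def by simp
      show "s I \<in> fob G I" if "I \<in> D A" for I
        using that M_mem[OF y(1)[OF in_S], of I I] unfolding s_def by (simp add: D_def)
      show "far G I L () (s I) = s L" if "I \<in> D A" "L \<in> D A" "L \<le> I" for I L
        using that M_res[OF y(1)[OF in_S], of I I L] y_res[OF in_S, of I L]
        unfolding s_def by (simp add: D_def)
    qed
    \<comment> \<open>One equivalence gives both halves of unique gluing.\<close>
    have char: "(\<forall>B\<in>S. far F A B () (c A z) = x B) \<longleftrightarrow> z = s" if z: "z \<in> M A" for z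
    proof
      assume *: "\<forall>B\<in>S. far F A B () (c A z) = x B"
      show "z = s"
      proof (rule M_ext[OF z s])
        fix I assume I: "I \<in> Q" "I \<le> A"
        note IS = in_S[OF I]
        have "c I (restrict z (D I)) = c I (y I)"
          using * IS F_res_c[OF A SP[OF IS] z] y(2)[OF IS] by simp
        then have "restrict z (D I) = y I"
          using c_inj[OF SP(1)[OF IS]] M_restrict[OF z I(2)] y(1)[OF IS] by (blast dest: inj_onD)
        then have "restrict z (D I) I = y I I"
          by simp
        then show "z I = s I"
          using I by (simp add: D_def s_def)
      qed
    next
      assume "z = s"
      have "restrict s (D B) = y B" if B: "B \<in> S" for B
      proof (rule M_ext[OF M_restrict[OF s SP(2)[OF B]] y(1)[OF B]])
        fix I assume "I \<in> Q" "I \<le> B"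
        then show "restrict s (D B) I = y B I"
          using y_res[OF B, of I] SP(2)[OF B] order_trans[of I B A] by (simp add: D_def s_def)
      qed
      then show "\<forall>B\<in>S. far F A B () (c A z) = x B"
        using \<open>z = s\<close> F_res_c[OF A SP s] y(2) by simp
    qed
    have "c A s \<in> fob F A \<and> (\<forall>B\<in>S. far F A B () (c A s) = x B)"
      using char[OF s] s A by (simp add: F_ob)
    moreover have "v = c A s" if "v \<in> fob F A \<and> (\<forall>B\<in>S. far F A B () v = x B)" for v
      using that char A by (auto simp: F_ob)
    ultimately show "\<exists>!v. v \<in> fob F A \<and> (\<forall>B\<in>S. far F A B () v = x B)"
      by blast
  qed
  \<comment> \<open>Evaluation at the top index: \<open>I\<close> is the greatest element of
    \<open>D I\<close>, so a matching family there is determined by its entry at \<open>I\<close>,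
    and every element of \<open>fob G I\<close> occurs as such an entry.\<close>
  define \<eta> where "\<eta> = (\<lambda>I\<in>Q. \<lambda>v\<in>c I ` M I. d I v I)"
  have \<eta>: "\<eta> I (c I x) = x I" if "I \<in> Q" "x \<in> M I" for I x
    unfolding \<eta>_def using that d Q_P by simp
  have \<eta>_map: "presheaf_map Q (fob restriction F) G \<eta>"
    unfolding presheaf_map_def
  proof (intro conjI ballI impI)
    show "\<eta> I \<in> fob (fob restriction F) I \<rightarrow>\<^sub>E fob G I" if "I \<in> Q" for I
      using that M_mem[OF _ that order_refl] by (auto simp: F_ob Q_P \<eta>) (simp add: \<eta>_def)
    show "\<eta> L (far (fob restriction F) I L () v) = far G I L () (\<eta> I v)"
      if IL: "I \<in> Q" "L \<in> Q" "L \<le> I" and v: "v \<in> fob (fob restriction F) I" for I L v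
    proof -
      obtain x where x: "x \<in> M I" "v = c I x"
        using v IL(1) by (auto simp: F_ob Q_P)
      have "\<eta> L (far (fob restriction F) I L () v) = restrict x (D L) L"
        using IL x by (simp add: F_res_c Q_P \<eta> M_restrict)
      also have "\<dots> = x L"
        using IL by (simp add: D_def)
      also have "\<dots> = far G I L () (\<eta> I v)"
        using M_res[OF x(1) IL(1,2) order_refl IL(3)] \<eta>[OF IL(1) x(1)] x(2) by simp
      finally show ?thesis .
    qed
  qed
  have \<eta>_bij: "bij_betw (\<eta> I) (fob (fob restriction F) I) (fob G I)" if I: "I \<in> Q" for I
  proof -
    have "inj_on (\<eta> I) (c I ` M I)"
    proof (rule inj_onI, clarify)
      fix x y assume x: "x \<in> M I" and y: "y \<in> M I" and "\<eta> I (c I x) = \<eta> I (c I y)"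
      then have xy: "x I = y I"
        using \<eta>[OF I] by simp
      have "x = y"
      proof (rule M_ext[OF x y])
        fix L assume L: "L \<in> Q" "L \<le> I"
        show "x L = y L"
          using M_res[OF x I L(1) order_refl L(2)] M_res[OF y I L(1) order_refl L(2)] xy by simp
      qed
      then show "c I x = c I y"
        by simp
    qed
    moreover have "\<eta> I ` c I ` M I = fob G I"
    proof (intro subset_antisym subsetI)
      fix g assume "g \<in> \<eta> I ` c I ` M I"
      then show "g \<in> fob G I"
        using \<eta>[OF I] M_mem[OF _ I order_refl] by auto
    next
      fix g assume g: "g \<in> fob G I"
      \<comment> \<open>The inverse of evaluation: all restrictions of \<open>g\<close>.\<close>
      define x where "x = (\<lambda>L\<in>D I. far G I L () g)"
      have "x \<in> M I"
        unfolding M_def matching_family_def x_def D_def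
        using presheafD(3)[OF G I _ _ g] presheafD(5)[OF G I _ _ _ _ g] by auto
      then have "g = \<eta> I (c I x)" "c I x \<in> c I ` M I"
        using \<eta>[OF I] I presheafD(4)[OF G I g] by (simp_all add: x_def D_def)
      then show "g \<in> \<eta> I ` c I ` M I"
        by (rule image_eqI)
    qed
    moreover have "fob (fob restriction F) I = c I ` M I"
      using restriction_simps(1)[OF I] F_ob[OF Q_P[OF I]] by (rule trans)
    ultimately show ?thesis
      unfolding bij_betw_def by metis
  qed
  have "\<eta> \<in> extensional Q"
    unfolding \<eta>_def by simp
  with \<eta>_map have "is_iso (presheaf_topos U Q) (fob restriction F) G \<eta>"
    by (rule is_iso_presheaf_topos[OF presheaf_restriction[OF F] G _ _ \<eta>_bij])
  moreover have "F \<in> Ob sheaves"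
    using F F_ext sh by (simp add: presheaf_topos_Ob)
  ultimately show ?thesis
    by blast
qed

text \<open>An instance of the comparison lemma for sites: a cover of an element of \<open>Q\<close>
  contains that element, so the topology imposes nothing on presheaves over
  \<open>Q\<close>.\<close>

theorem comparison: "equivalent_categories sheaves (presheaf_topos U Q)"
proof (rule equivalent_categoriesI)
  show "is_functor sheaves (presheaf_topos U Q) restriction"
    by (rule is_functor_restriction)
qed (auto intro!: category_full_subcat category_presheaf_topos restriction_fully_faithful
    restriction_essentially_surjective simp: presheaf_topos_Ob simp del: full_subcat_simps
    restriction_simps)

end


section \<open>Irreducible connected sets\<close>

lemma generated_mono:
  "\<A> \<subseteq> \<B> \<Longrightarrow> generated X \<A> \<subseteq> generated X \<B>"
  unfolding generated_def by blast

lemma connectivity_spaceD: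
  assumes "connectivity_space X K"
  shows "K \<subseteq> Pow X" and "{} \<in> K" and "\<F> \<subseteq> K \<Longrightarrow> \<Inter>\<F> \<noteq> {} \<Longrightarrow> \<Union>\<F> \<in> K"
  using assms by (simp_all add: connectivity_space_def)

lemma connectivity_space_below:
  assumes "connectivity_space X K"
  shows "connectivity_space X (K \<inter> Pow A)"
  unfolding connectivity_space_def
proof (intro conjI allI impI)
  fix \<F> assume \<F>: "\<F> \<subseteq> K \<inter> Pow A \<and> \<Inter>\<F> \<noteq> {}"
  then have "\<Union>\<F> \<in> K"
    using connectivity_spaceD(3)[OF assms] by simp
  then show "\<Union>\<F> \<in> K \<inter> Pow A"
    using \<F> by blast
qed (use connectivity_spaceD(1,2)[OF assms] in auto)

text \<open>Sets not contained in \<open>A\<close> cannot help to generate \<open>A\<close>: adding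
  all of them to the structure \<open>L\<close> generated by the proper connected subsets gives a
  connectivity structure containing \<open>K - {A}\<close>. It therefore contains \<open>A\<close>,
  and \<open>A\<close> can only come from \<open>L\<close>.\<close>

lemma generated_proper_subsets:
  assumes K: "connectivity_space X K" and A: "A \<in> generated X (K - {A})"
  shows "A \<in> generated X (K \<inter> Pow A - {A})"
proof -
  define L where "L = generated X (K \<inter> Pow A - {A})"
  have KX: "K \<subseteq> Pow X"
    using K by (rule connectivity_spaceD)
  have L: "connectivity_space X L"
    unfolding L_def using KX by (intro connectivity_space_generated) blast
  have LK: "L \<subseteq> K"
    unfolding L_def using K by (intro generated_least) auto
  have "connectivity_space X (L \<union> {B \<in> K. \<not> B \<subseteq> A})"
    unfolding connectivity_space_def
  proof (intro conjI allI impI)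
    show "L \<union> {B \<in> K. \<not> B \<subseteq> A} \<subseteq> Pow X"
      using LK KX by blast
    show "{} \<in> L \<union> {B \<in> K. \<not> B \<subseteq> A}"
      using connectivity_spaceD(2)[OF L] by blast
    fix \<F> assume \<F>: "\<F> \<subseteq> L \<union> {B \<in> K. \<not> B \<subseteq> A} \<and> \<Inter>\<F> \<noteq> {}"
    show "\<Union>\<F> \<in> L \<union> {B \<in> K. \<not> B \<subseteq> A}"
    proof (cases "\<F> \<subseteq> L")
      case True
      then show ?thesis
        using connectivity_spaceD(3)[OF L] \<F> by blast
    next
      case False
      \<comment> \<open>A member outside \<open>L\<close> already sticks out of \<open>A\<close>,
        hence so does the union.\<close>
      then have "\<not> \<Union>\<F> \<subseteq> A"
        using \<F> by blast
      moreover have "\<Union>\<F> \<in> K"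
        using \<F> LK by (intro connectivity_spaceD(3)[OF K]) blast+
      ultimately show ?thesis
        by blast
    qed
  qed
  moreover have "K - {A} \<subseteq> L \<union> {B \<in> K. \<not> B \<subseteq> A}"
    unfolding L_def using subset_generated[of "K \<inter> Pow A - {A}" X] by blast
  ultimately have "generated X (K - {A}) \<subseteq> L \<union> {B \<in> K. \<not> B \<subseteq> A}"
    by (rule generated_least)
  then show ?thesis
    using A unfolding L_def by blast
qed

text \<open>If \<open>A\<close> is reducible, its proper connected subsets generate it, and the
  induction hypothesis applies to each of them. The empty set needs no separate base case: it is
  reducible, and every generated structure contains it.\<close>

lemma mem_generated_Irr:
  assumes K: "connectivity_space X K" and "finite X" and "A \<in> K"
  shows "A \<in> generated X (Irr X K \<inter> Pow A)"
proof -
  have KX: "K \<subseteq> Pow X"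
    using K by (rule connectivity_spaceD)
  have "finite A"
    using assms(2,3) KX finite_subset by blast
  then show ?thesis
    using \<open>A \<in> K\<close>
  proof (induction A rule: finite_psubset_induct)
    case (psubset A)
    show ?case
    proof (cases "A \<in> Irr X K")
      case True
      then show ?thesis
        using subset_generated[of "Irr X K \<inter> Pow A" X] by blast
    next
      case False
      then have "A \<in> generated X (K \<inter> Pow A - {A})"
        using generated_proper_subsets[OF K] psubset.prems unfolding Irr_def by blast
      moreover have "B \<in> generated X (Irr X K \<inter> Pow A)" if "B \<in> K \<inter> Pow A - {A}" for B
        using psubset.IH[of B] generated_mono[of "Irr X K \<inter> Pow B" "Irr X K \<inter> Pow A" X] that
        by blast
      then have "generated X (K \<inter> Pow A - {A}) \<subseteq> generated X (Irr X K \<inter> Pow A)"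
        using KX by (intro generated_least connectivity_space_generated) (auto simp: Irr_def)
      ultimately show ?thesis
        by blast
    qed
  qed
qed

text \<open>Covering requires every connected \<open>B \<subseteq> A\<close> to be generated, not
  just \<open>A\<close>; the irreducible sets below \<open>B\<close> all belong to the sieve and
  generate \<open>B\<close>. For \<open>A = {}\<close> the sieve is empty and still covers.\<close>

lemma generated_below_Irr:
  assumes K: "connectivity_space X K" and "finite X" and A: "A \<in> K"
  shows "{B \<in> K. \<exists>I\<in>Irr X K. B \<subseteq> I \<and> I \<subseteq> A} \<in> covering_sieves X K A"
proof -
  let ?S = "{B \<in> K. \<exists>I\<in>Irr X K. B \<subseteq> I \<and> I \<subseteq> A}"
  have "generated X ?S \<subseteq> K \<inter> Pow A"
    by (intro generated_least connectivity_space_below[OF K]) blast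
  moreover have "B \<in> generated X ?S" if B: "B \<in> K \<inter> Pow A" for B
  proof -
    have "Irr X K \<inter> Pow B \<subseteq> ?S"
      using B unfolding Irr_def by blast
    then show ?thesis
      using mem_generated_Irr[OF K assms(2), of B] generated_mono[of _ ?S X] B by blast
  qed
  ultimately have "generated X ?S = K \<inter> Pow A"
    by blast
  moreover have "is_sieve K A ?S"
    unfolding is_sieve_def by blast
  ultimately show ?thesis
    unfolding covering_sieves_def by simp
qed

text \<open>\<open>I\<close> lies in \<open>K \<inter> Pow A\<close>, the structure generated by
  \<open>S\<close>. Were \<open>I\<close> missing from \<open>S\<close>, then
  \<open>S \<subseteq> K - {I}\<close> would generate it.\<close>

lemma Irr_mem_covering_sieve:
  assumes S: "S \<in> covering_sieves X K A" and I: "I \<in> Irr X K" "I \<subseteq> A"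
  shows "I \<in> S"
proof (rule ccontr)
  assume "I \<notin> S"
  then have "S \<subseteq> K - {I}"
    using S unfolding covering_sieves_def is_sieve_def by blast
  then have "generated X S \<subseteq> generated X (K - {I})"
    by (rule generated_mono)
  moreover have "I \<in> generated X S"
    using S I unfolding covering_sieves_def Irr_def by blast
  ultimately show False
    using I(1) unfolding Irr_def by blast
qed

theorem proposition8:
  fixes X :: "'a set" and K :: "'a set set" and U :: "'v set set"
  assumes "set_universe U"
    and "connectivity_space X K"
    and "finite X"
  shows "equivalent_categories (sheaf_topos U X K) (presheaf_topos U (Irr X K))"
proof -
  have "K \<subseteq> Pow X"
    using assms(2) by (rule connectivity_spaceD)
  then have "finite K"
    using assms(3) by (simp add: finite_subset)
  \<comment> \<open>For sets, \<open>\<le>\<close> is inclusion, so \<open>Q_covers\<close> and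
    \<open>Q_in_cover\<close> are \<open>generated_below_Irr\<close> and
    \<open>Irr_mem_covering_sieve\<close>; \<open>finite_below\<close> holds because
    \<open>K\<close> is finite.\<close>
  have "rigid_site U K (Irr X K) (covering_sieves X K)"
  proof
    show "Irr X K \<subseteq> K"
      unfolding Irr_def by blast
    then show "finite {I \<in> Irr X K. I \<subseteq> A}" for A
      using \<open>finite K\<close> by (simp add: finite_subset)
    show "B \<in> K \<and> B \<subseteq> A" if "S \<in> covering_sieves X K A" "B \<in> S" for A S B
      using that unfolding covering_sieves_def is_sieve_def by blast
  qed (use assms generated_below_Irr Irr_mem_covering_sieve in auto)
  then show ?thesis
    unfolding sheaf_topos_def by (rule rigid_site.comparison)
qed

end
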